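(* Let $(A,1,\Delta,\varepsilon)$ be a weak bialgebra. (i) The following are equivalent: $A$ is left-comonoidal; $A_L=N_{LL}(A)$; $A_R=N_{RR}(A)$. If these hold, then also $N_{\sigma\sigma}(\hat A)=\hat A_{\sigma\sigma}$ and $N_{\sigma\sigma}(A)=A_{\sigma\sigma}$ for $\sigma=L$ and $\sigma=R$. (ii) The following are equivalent: $A$ is right-comonoidal; $A_L=N_{LR}(A)$; $A_R=N_{RL}(A)$. If these hold, then also $N_{\sigma\sigma'}(\hat A)=\hat A_{\sigma\sigma'}$ and $N_{\sigma\sigma'}(A)=A_{\sigma\sigma'}$ for $(\sigma,\sigma')=(L,R)$ and $(\sigma,\sigma')=(R,L)$.
   Context: $K$ is a field and all spaces are finite dimensional over $K$. A weak bialgebra $(A,1,\Delta,\varepsilon)$ is a unital associative $K$-algebra $(A,1)$ which is also a coassociative coalgebra with coproduct $\Delta$ and counit $\varepsilon$, such that $\Delta(ab)=\Delta(a)\Delta(b)$ for all $a,b$; neither $\Delta(1)=1\otimes1$ nor multiplicativity of $\varepsilon$ is required. Sweedler notation is used. The dual $\hat A=\mathrm{Hom}_K(A,K)$ is a weak bialgebra with product $\langle\phi\psi\mid a\rangle=\langle\phi\otimes\psi\mid\Delta(a)\rangle$, unit $\hat1=\varepsilon$, coproduct $\langle\hat\Delta(\phi)\mid a\otimes b\rangle=\langle\phi\mid ab\rangle$, counit $\hat\varepsilon(\phi)=\langle\phi\mid1\rangle$. $A$ is left-comonoidal if $(\Delta(1)\otimes1)(1\otimes\Delta(1))=1_{(1)}\otimes1_{(2)}\otimes1_{(3)}$,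 and right-comonoidal if $(1\otimes\Delta(1))(\Delta(1)\otimes1)=1_{(1)}\otimes1_{(2)}\otimes1_{(3)}$. Define $\varepsilon_L,\varepsilon_R:A\to\hat A$ by $\langle\varepsilon_L(a)\mid b\rangle=\varepsilon(ab)$, $\langle\varepsilon_R(a)\mid b\rangle=\varepsilon(ba)$, and $\hat\varepsilon_L,\hat\varepsilon_R:\hat A\to A$ by $\hat\varepsilon_L(\phi)=\langle\phi\mid1_{(1)}\rangle1_{(2)}$, $\hat\varepsilon_R(\phi)=1_{(1)}\langle\phi\mid1_{(2)}\rangle$. Put $A_L=\hat\varepsilon_L(\hat A)$, $A_R=\hat\varepsilon_R(\hat A)$. For $\sigma,\sigma'\in\{L,R\}$ put $\varepsilon_{\sigma\sigma'}=\hat\varepsilon_\sigma\circ\varepsilon_{\sigma'}:A\to A$, $\hat\varepsilon_{\sigma\sigma'}=\varepsilon_\sigma\circ\hat\varepsilon_{\sigma'}:\hat A\to\hat A$, $A_{\sigma\sigma'}=\varepsilon_{\sigma\sigma'}(A)$, $\hat A_{\sigma\sigma'}=\hat\varepsilon_{\sigma\sigma'}(\hat A)$. Further, $N_{LL}(A)=\{a\in A:\Delta(a)=a1_{(1)}\otimes1_{(2)}\}$, $N_{LR}(A)=\{a\in A:\Delta(a)=1_{(1)}a\otimes1_{(2)}\}$, $N_{RL}(A)=\{a\in A:\Delta(a)=1_{(1)}\otimes a1_{(2)}\}$, $N_{RR}(A)=\{a\in A:\Delta(a)=1_{(1)}\otimes1_{(2)}a\}$, and $N_{\sigma\sigma'}(\hat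 A)\subset\hat A$ is defined by the same formulas in the weak bialgebra $\hat A$. *)

theory Defs
  imports Complex_Main "HOL-Library.Function_Algebras"
begin

text \<open>
  Vector spaces are subspaces \<open>V\<close> of an ambient space given by a scalar multiplication \<open>s\<close>
  on a type, so that the dual (a space of functions) is covered by the same definitions.
\<close>

definition linear_form_on ::
  "('k::field \<Rightarrow> 'a::ab_group_add \<Rightarrow> 'a) \<Rightarrow> 'a set \<Rightarrow> ('a \<Rightarrow> 'k) \<Rightarrow> bool" where
  "linear_form_on s V f \<longleftrightarrow>
     (\<forall>x\<in>V. \<forall>y\<in>V. f (x + y) = f x + f y) \<and> (\<forall>c. \<forall>x\<in>V. f (s c x) = c * f x)"

definition bilinear_form_on ::
  "('k::field \<Rightarrow> 'a::ab_group_add \<Rightarrow> 'a) \<Rightarrow> 'a set \<Rightarrow> ('a \<Rightarrow> 'a \<Rightarrow> 'k) \<Rightarrow> bool" where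
  "bilinear_form_on s V f \<longleftrightarrow>
     (\<forall>y\<in>V. linear_form_on s V (\<lambda>x. f x y)) \<and>
     (\<forall>x\<in>V. linear_form_on s V (\<lambda>y. f x y))"

definition trilinear_form_on ::
  "('k::field \<Rightarrow> 'a::ab_group_add \<Rightarrow> 'a) \<Rightarrow> 'a set \<Rightarrow> ('a \<Rightarrow> 'a \<Rightarrow> 'a \<Rightarrow> 'k) \<Rightarrow> bool" where
  "trilinear_form_on s V f \<longleftrightarrow>
     (\<forall>y\<in>V. \<forall>z\<in>V. linear_form_on s V (\<lambda>x. f x y z)) \<and>
     (\<forall>x\<in>V. \<forall>z\<in>V. linear_form_on s V (\<lambda>y. f x y z)) \<and>
     (\<forall>x\<in>V. \<forall>y\<in>V. linear_form_on s V (\<lambda>z. f x y z))"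

text \<open>
  An element \<open>t\<close> of \<open>V \<otimes> V\<close> is represented by its evaluation on bilinear forms: if
  \<open>t = \<Sum>i. a\<^sub>i \<otimes> b\<^sub>i\<close>, then \<open>t f = (\<Sum>i. f a\<^sub>i b\<^sub>i)\<close> for every bilinear form \<open>f\<close> on \<open>V\<close>. Over a
  field the bilinear forms separate the points of \<open>V \<otimes> V\<close>, so the span of the functionals
  representing pure tensors is the tensor square. A tensor takes the value \<open>0\<close> on functions
  that are not bilinear on \<open>V\<close>, and the values of a form outside \<open>V\<close> are immaterial; hence
  equality of tensors is equality of functions. Elements of \<open>V \<otimes> V \<otimes> V\<close> are represented
  likewise by their evaluation on trilinear forms.

  In this representation Sweedler notation can be read off directly: \<open>\<Delta>(a) f\<close> is
  \<open>f(a\<^sub>1, a\<^sub>2)\<close>, summation understood.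
\<close>

type_synonym ('k, 'a) tensor2 = "('a \<Rightarrow> 'a \<Rightarrow> 'k) \<Rightarrow> 'k"
type_synonym ('k, 'a) tensor3 = "('a \<Rightarrow> 'a \<Rightarrow> 'a \<Rightarrow> 'k) \<Rightarrow> 'k"

definition pure_tensor2 ::
  "('k::field \<Rightarrow> 'a::ab_group_add \<Rightarrow> 'a) \<Rightarrow> 'a set \<Rightarrow> 'a \<Rightarrow> 'a \<Rightarrow> ('k, 'a) tensor2" where
  "pure_tensor2 s V a b = (\<lambda>f. if bilinear_form_on s V f then f a b else 0)"

definition fun_scale :: "'k::field \<Rightarrow> ('b \<Rightarrow> 'k) \<Rightarrow> 'b \<Rightarrow> 'k" where
  "fun_scale c t = (\<lambda>x. c * t x)"

definition tensor_square ::
  "('k::field \<Rightarrow> 'a::ab_group_add \<Rightarrow> 'a) \<Rightarrow> 'a set \<Rightarrow> ('k, 'a) tensor2 set" where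
  "tensor_square s V = module.span fun_scale {pure_tensor2 s V a b | a b. a \<in> V \<and> b \<in> V}"

record ('k, 'a) weak_bialg =
  carrier :: "'a set"
  scal :: "'k \<Rightarrow> 'a \<Rightarrow> 'a"
  mult :: "'a \<Rightarrow> 'a \<Rightarrow> 'a" (infixl \<open>\<cdot>\<index>\<close> 70)
  unit :: "'a" (\<open>\<one>\<index>\<close>)
  comult :: "'a \<Rightarrow> ('k, 'a) tensor2" (\<open>\<Delta>\<index>\<close>)
  counit :: "'a \<Rightarrow> 'k" (\<open>\<epsilon>\<index>\<close>)

abbreviation bilin :: "('k::field, 'a::ab_group_add) weak_bialg \<Rightarrow> ('a \<Rightarrow> 'a \<Rightarrow> 'k) \<Rightarrow> bool" where
  "bilin A \<equiv> bilinear_form_on (scal A) (carrier A)"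

abbreviation trilin ::
  "('k::field, 'a::ab_group_add) weak_bialg \<Rightarrow> ('a \<Rightarrow> 'a \<Rightarrow> 'a \<Rightarrow> 'k) \<Rightarrow> bool" where
  "trilin A \<equiv> trilinear_form_on (scal A) (carrier A)"

text \<open>The product \<open>s t\<close> of the algebra \<open>A \<otimes> A\<close>, and likewise for \<open>A \<otimes> A \<otimes> A\<close>.\<close>

definition tmult2 :: "('k::field, 'a::ab_group_add) weak_bialg \<Rightarrow>
    ('k, 'a) tensor2 \<Rightarrow> ('k, 'a) tensor2 \<Rightarrow> ('k, 'a) tensor2" where
  "tmult2 A s t = (\<lambda>f. if bilin A f
     then s (\<lambda>a b. t (\<lambda>c d. f (a \<cdot>\<^bsub>A\<^esub> c) (b \<cdot>\<^bsub>A\<^esub> d))) else 0)"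

definition tmult3 :: "('k::field, 'a::ab_group_add) weak_bialg \<Rightarrow>
    ('k, 'a) tensor3 \<Rightarrow> ('k, 'a) tensor3 \<Rightarrow> ('k, 'a) tensor3" where
  "tmult3 A s t = (\<lambda>f. if trilin A f
     then s (\<lambda>a b c. t (\<lambda>x y z. f (a \<cdot>\<^bsub>A\<^esub> x) (b \<cdot>\<^bsub>A\<^esub> y) (c \<cdot>\<^bsub>A\<^esub> z))) else 0)"

text \<open>\<open>t \<otimes> a\<close> and \<open>a \<otimes> t\<close> for a tensor \<open>t\<close> in \<open>A \<otimes> A\<close> and \<open>a\<close> in \<open>A\<close>.\<close>

definition tensor21 :: "('k::field, 'a::ab_group_add) weak_bialg \<Rightarrow>
    ('k, 'a) tensor2 \<Rightarrow> 'a \<Rightarrow> ('k, 'a) tensor3" where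
  "tensor21 A t a = (\<lambda>f. if trilin A f then t (\<lambda>x y. f x y a) else 0)"

definition tensor12 :: "('k::field, 'a::ab_group_add) weak_bialg \<Rightarrow>
    'a \<Rightarrow> ('k, 'a) tensor2 \<Rightarrow> ('k, 'a) tensor3" where
  "tensor12 A a t = (\<lambda>f. if trilin A f then t (\<lambda>y z. f a y z) else 0)"

text \<open>\<open>(g \<otimes> h)(t)\<close> for linear endomorphisms \<open>g\<close>, \<open>h\<close>; \<open>(\<Delta> \<otimes> id)(t)\<close>; \<open>(id \<otimes> \<Delta>)(t)\<close>.\<close>

definition tmap :: "('k::field, 'a::ab_group_add) weak_bialg \<Rightarrow>
    ('a \<Rightarrow> 'a) \<Rightarrow> ('a \<Rightarrow> 'a) \<Rightarrow> ('k, 'a) tensor2 \<Rightarrow> ('k, 'a) tensor2" where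
  "tmap A g h t = (\<lambda>f. if bilin A f then t (\<lambda>x y. f (g x) (h y)) else 0)"

definition comult_left :: "('k::field, 'a::ab_group_add) weak_bialg \<Rightarrow>
    ('k, 'a) tensor2 \<Rightarrow> ('k, 'a) tensor3" where
  "comult_left A t = (\<lambda>f. if trilin A f then t (\<lambda>a z. \<Delta>\<^bsub>A\<^esub> a (\<lambda>x y. f x y z)) else 0)"

definition comult_right :: "('k::field, 'a::ab_group_add) weak_bialg \<Rightarrow>
    ('k, 'a) tensor2 \<Rightarrow> ('k, 'a) tensor3" where
  "comult_right A t = (\<lambda>f. if trilin A f then t (\<lambda>x a. \<Delta>\<^bsub>A\<^esub> a (\<lambda>y z. f x y z)) else 0)"

text \<open>
  The value at \<open>t\<close> of the linear map \<open>A \<otimes> A \<rightarrow> A\<close> induced by a bilinear map \<open>F\<close>; it is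
  characterized by its values under all linear forms, which separate the points of \<open>A\<close>.
\<close>

definition tlift :: "('k::field, 'a::ab_group_add) weak_bialg \<Rightarrow>
    ('a \<Rightarrow> 'a \<Rightarrow> 'a) \<Rightarrow> ('k, 'a) tensor2 \<Rightarrow> 'a" where
  "tlift A F t = (THE v. v \<in> carrier A \<and>
     (\<forall>\<psi>. linear_form_on (scal A) (carrier A) \<psi> \<longrightarrow> \<psi> v = t (\<lambda>x y. \<psi> (F x y))))"

locale weak_bialgebra =
  fixes A :: "('k::field, 'a::ab_group_add) weak_bialg" (structure)
  assumes vector_space: "vector_space (scal A)"
    and subspace: "module.subspace (scal A) (carrier A)"
    and finite_dimensional: "\<exists>B. finite B \<and> module.span (scal A) B = carrier A"
    \<comment> \<open>unital associative algebra\<close>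
    and mult_closed: "\<lbrakk>a \<in> carrier A; b \<in> carrier A\<rbrakk> \<Longrightarrow> a \<cdot> b \<in> carrier A"
    and mult_add_left: "\<lbrakk>a \<in> carrier A; b \<in> carrier A; c \<in> carrier A\<rbrakk>
      \<Longrightarrow> (a + b) \<cdot> c = a \<cdot> c + b \<cdot> c"
    and mult_add_right: "\<lbrakk>a \<in> carrier A; b \<in> carrier A; c \<in> carrier A\<rbrakk>
      \<Longrightarrow> a \<cdot> (b + c) = a \<cdot> b + a \<cdot> c"
    and mult_scal_left: "\<lbrakk>a \<in> carrier A; b \<in> carrier A\<rbrakk> \<Longrightarrow> scal A k a \<cdot> b = scal A k (a \<cdot> b)"
    and mult_scal_right: "\<lbrakk>a \<in> carrier A; b \<in> carrier A\<rbrakk> \<Longrightarrow> a \<cdot> scal A k b = scal A k (a \<cdot> b)"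
    and mult_assoc: "\<lbrakk>a \<in> carrier A; b \<in> carrier A; c \<in> carrier A\<rbrakk>
      \<Longrightarrow> (a \<cdot> b) \<cdot> c = a \<cdot> (b \<cdot> c)"
    and unit_closed: "\<one> \<in> carrier A"
    and unit_left: "a \<in> carrier A \<Longrightarrow> \<one> \<cdot> a = a"
    and unit_right: "a \<in> carrier A \<Longrightarrow> a \<cdot> \<one> = a"
    \<comment> \<open>counital coassociative coalgebra\<close>
    and comult_closed: "a \<in> carrier A \<Longrightarrow> \<Delta> a \<in> tensor_square (scal A) (carrier A)"
    and comult_add: "\<lbrakk>a \<in> carrier A; b \<in> carrier A\<rbrakk> \<Longrightarrow> \<Delta> (a + b) = \<Delta> a + \<Delta> b"
    and comult_scal: "a \<in> carrier A \<Longrightarrow> \<Delta> (scal A k a) = fun_scale k (\<Delta> a)"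
    and counit_linear: "linear_form_on (scal A) (carrier A) \<epsilon>"
    and coassoc: "a \<in> carrier A \<Longrightarrow> comult_left A (\<Delta> a) = comult_right A (\<Delta> a)"
    and counit_left: "a \<in> carrier A \<Longrightarrow> tlift A (\<lambda>x y. scal A (\<epsilon> x) y) (\<Delta> a) = a"
    and counit_right: "a \<in> carrier A \<Longrightarrow> tlift A (\<lambda>x y. scal A (\<epsilon> y) x) (\<Delta> a) = a"
    \<comment> \<open>compatibility\<close>
    and comult_mult: "\<lbrakk>a \<in> carrier A; b \<in> carrier A\<rbrakk> \<Longrightarrow> \<Delta> (a \<cdot> b) = tmult2 A (\<Delta> a) (\<Delta> b)"

text \<open>
  Linear forms on the carrier are extended by \<open>0\<close> to functions on the ambient type. The
  coproduct of \<open>\<phi>\<close> is the tensor \<open>T\<close> with \<open>\<langle>T | a \<otimes> b\<rangle> = \<langle>\<phi> | a b\<rangle>\<close>, which exists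
  and is unique in finite dimension.
\<close>

definition dual_carrier :: "('k::field, 'a::ab_group_add) weak_bialg \<Rightarrow> ('a \<Rightarrow> 'k) set" where
  "dual_carrier A = {\<phi>. linear_form_on (scal A) (carrier A) \<phi> \<and> (\<forall>x. x \<notin> carrier A \<longrightarrow> \<phi> x = 0)}"

definition dual ::
  "('k::field, 'a::ab_group_add) weak_bialg \<Rightarrow> ('k, 'a \<Rightarrow> 'k) weak_bialg" where
  "dual A = \<lparr>
     carrier = dual_carrier A,
     scal = fun_scale,
     mult = (\<lambda>\<phi> \<psi> a. if a \<in> carrier A then \<Delta>\<^bsub>A\<^esub> a (\<lambda>x y. \<phi> x * \<psi> y) else 0),
     unit = (\<lambda>a. if a \<in> carrier A then \<epsilon>\<^bsub>A\<^esub> a else 0),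
     comult = (\<lambda>\<phi>. THE T. T \<in> tensor_square fun_scale (dual_carrier A) \<and>
        (\<forall>a\<in>carrier A. \<forall>b\<in>carrier A. T (\<lambda>\<phi>\<^sub>1 \<phi>\<^sub>2. \<phi>\<^sub>1 a * \<phi>\<^sub>2 b) = \<phi> (a \<cdot>\<^bsub>A\<^esub> b))),
     counit = (\<lambda>\<phi>. \<phi> \<one>\<^bsub>A\<^esub>)\<rparr>"

definition left_comonoidal :: "('k::field, 'a::ab_group_add) weak_bialg \<Rightarrow> bool" where
  "left_comonoidal A \<longleftrightarrow>
     tmult3 A (tensor21 A (\<Delta>\<^bsub>A\<^esub> \<one>\<^bsub>A\<^esub>) \<one>\<^bsub>A\<^esub>) (tensor12 A \<one>\<^bsub>A\<^esub> (\<Delta>\<^bsub>A\<^esub> \<one>\<^bsub>A\<^esub>))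
       = comult_left A (\<Delta>\<^bsub>A\<^esub> \<one>\<^bsub>A\<^esub>)"

definition right_comonoidal :: "('k::field, 'a::ab_group_add) weak_bialg \<Rightarrow> bool" where
  "right_comonoidal A \<longleftrightarrow>
     tmult3 A (tensor12 A \<one>\<^bsub>A\<^esub> (\<Delta>\<^bsub>A\<^esub> \<one>\<^bsub>A\<^esub>)) (tensor21 A (\<Delta>\<^bsub>A\<^esub> \<one>\<^bsub>A\<^esub>) \<one>\<^bsub>A\<^esub>)
       = comult_left A (\<Delta>\<^bsub>A\<^esub> \<one>\<^bsub>A\<^esub>)"

datatype side = L | R

text \<open>
  \<open>eps A \<sigma>\<close> is \<open>\<epsilon>\<^sub>\<sigma>\<close>, from \<open>A\<close> to its dual, and \<open>eps_hat A \<sigma>\<close> is the map from the dual to \<open>A\<close>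
  written with a hat.
\<close>

fun eps :: "('k::field, 'a::ab_group_add) weak_bialg \<Rightarrow> side \<Rightarrow> 'a \<Rightarrow> ('a \<Rightarrow> 'k)" where
  "eps A L a = (\<lambda>b. if b \<in> carrier A then \<epsilon>\<^bsub>A\<^esub> (a \<cdot>\<^bsub>A\<^esub> b) else 0)"
| "eps A R a = (\<lambda>b. if b \<in> carrier A then \<epsilon>\<^bsub>A\<^esub> (b \<cdot>\<^bsub>A\<^esub> a) else 0)"

fun eps_hat :: "('k::field, 'a::ab_group_add) weak_bialg \<Rightarrow> side \<Rightarrow> ('a \<Rightarrow> 'k) \<Rightarrow> 'a" where
  "eps_hat A L \<phi> = tlift A (\<lambda>x y. scal A (\<phi> x) y) (\<Delta>\<^bsub>A\<^esub> \<one>\<^bsub>A\<^esub>)"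
| "eps_hat A R \<phi> = tlift A (\<lambda>x y. scal A (\<phi> y) x) (\<Delta>\<^bsub>A\<^esub> \<one>\<^bsub>A\<^esub>)"

text \<open>
  \<open>range1 A \<sigma>\<close> and \<open>range2 A \<sigma> \<sigma>'\<close> are the subspaces of \<open>A\<close> denoted by \<open>A\<close> with subscript \<open>\<sigma>\<close>
  and \<open>\<sigma>\<sigma>'\<close>, respectively; \<open>range2_hat A \<sigma> \<sigma>'\<close> is the subspace of the dual denoted by a hatted
  \<open>A\<close> with subscript \<open>\<sigma>\<sigma>'\<close>.
\<close>

definition range1 :: "('k::field, 'a::ab_group_add) weak_bialg \<Rightarrow> side \<Rightarrow> 'a set" where
  "range1 A \<sigma> = eps_hat A \<sigma> ` carrier (dual A)"

definition range2 :: "('k::field, 'a::ab_group_add) weak_bialg \<Rightarrow> side \<Rightarrow> side \<Rightarrow> 'a set" where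
  "range2 A \<sigma> \<sigma>' = (eps_hat A \<sigma> \<circ> eps A \<sigma>') ` carrier A"

definition range2_hat ::
  "('k::field, 'a::ab_group_add) weak_bialg \<Rightarrow> side \<Rightarrow> side \<Rightarrow> ('a \<Rightarrow> 'k) set" where
  "range2_hat A \<sigma> \<sigma>' = (eps A \<sigma> \<circ> eps_hat A \<sigma>') ` carrier (dual A)"

fun N :: "side \<Rightarrow> side \<Rightarrow> ('k::field, 'a::ab_group_add) weak_bialg \<Rightarrow> 'a set" where
  "N L L A = {a \<in> carrier A. \<Delta>\<^bsub>A\<^esub> a = tmap A (\<lambda>x. a \<cdot>\<^bsub>A\<^esub> x) (\<lambda>y. y) (\<Delta>\<^bsub>A\<^esub> \<one>\<^bsub>A\<^esub>)}"
| "N L R A = {a \<in> carrier A. \<Delta>\<^bsub>A\<^esub> a = tmap A (\<lambda>x. x \<cdot>\<^bsub>A\<^esub> a) (\<lambda>y. y) (\<Delta>\<^bsub>A\<^esub> \<one>\<^bsub>A\<^esub>)}"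
| "N R L A = {a \<in> carrier A. \<Delta>\<^bsub>A\<^esub> a = tmap A (\<lambda>x. x) (\<lambda>y. a \<cdot>\<^bsub>A\<^esub> y) (\<Delta>\<^bsub>A\<^esub> \<one>\<^bsub>A\<^esub>)}"
| "N R R A = {a \<in> carrier A. \<Delta>\<^bsub>A\<^esub> a = tmap A (\<lambda>x. x) (\<lambda>y. y \<cdot>\<^bsub>A\<^esub> a) (\<Delta>\<^bsub>A\<^esub> \<one>\<^bsub>A\<^esub>)}"

end

theory Submission
  imports Defs
begin

text \<open>
  Contracting one leg of the comonoidality identity with all forms shows that left-comonoidality
  means \<open>A\<^sub>L \<subseteq> N\<^sub>L\<^sub>L\<close> (first leg) and also that it means \<open>A\<^sub>R \<subseteq> N\<^sub>R\<^sub>R\<close> (third leg). Applying the counit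
  to \<open>\<Delta>(a) = a1\<^sub>1 \<otimes> 1\<^sub>2\<close> gives \<open>N\<^sub>L\<^sub>L \<subseteq> A\<^sub>L\<^sub>L \<subseteq> A\<^sub>L\<close> unconditionally, and likewise on the right. In the dual,
  \<open>\<phi>\<close> lies in \<open>N\<^sub>L\<^sub>L\<close> iff \<open>\<phi>(ab) = \<phi>(a\<^sub>1)\<epsilon>(a\<^sub>2b)\<close>; putting \<open>a = 1\<close> gives one inclusion, and the other holds
  since \<open>\<Delta>(xa) = xa\<^sub>1 \<otimes> a\<^sub>2\<close> for \<open>x\<close> in \<open>N\<^sub>L\<^sub>L\<close>. The second part is the first one for the opposite algebra.
\<close>

section \<open>Tensors over finite-dimensional spaces\<close>

text \<open>Every tensor here is a functional with default value \<open>0\<close>. A Sweedler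
  manipulation therefore has two parts: the identity itself, and the check that the function being
  evaluated is multilinear. This shapes the lemmas on congruence, linearity in a parameter and
  interchange of contractions. The coproduct of the dual is a definite description, accessible only
  through its pairing with pure tensors. Finite dimension makes these pairings decisive, so a
  condition on \<open>\<phi>\<close> in the dual becomes a scalar identity for
  \<open>\<phi>(ab)\<close> with \<open>a\<close>, \<open>b\<close> in \<open>A\<close>.

  Passing to the opposite algebra reverses the product in the middle leg and so exchanges the two
  comonoidality conditions. It keeps \<open>\<Delta>(1)\<close>, hence both maps
  \<open>eps_hat\<close>, and exchanges \<open>\<epsilon>\<^sub>L\<close> with
  \<open>\<epsilon>\<^sub>R\<close>; in \<open>A\<close> it therefore changes the second index of
  \<open>N\<close> and \<open>range2\<close>. In the dual it flips the legs of the coproduct and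
  changes the first index instead.\<close>

interpretation fun_scale: vector_space "fun_scale :: 'k::field \<Rightarrow> ('b \<Rightarrow> 'k) \<Rightarrow> 'b \<Rightarrow> 'k"
  by unfold_locales (auto simp: fun_scale_def fun_eq_iff algebra_simps)

lemma sum_fun_apply: "(\<Sum>i\<in>I. f i) x = (\<Sum>i\<in>I. f i x)"
  by (induction I rule: infinite_finite_induct) auto

lemma bilinear_form_onI:
  assumes "\<And>x x' y. \<lbrakk>x \<in> V; x' \<in> V; y \<in> V\<rbrakk> \<Longrightarrow> f (x + x') y = f x y + f x' y"
    and "\<And>c x y. \<lbrakk>x \<in> V; y \<in> V\<rbrakk> \<Longrightarrow> f (s c x) y = c * f x y"
    and "\<And>x y y'. \<lbrakk>x \<in> V; y \<in> V; y' \<in> V\<rbrakk> \<Longrightarrow> f x (y + y') = f x y + f x y'"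
    and "\<And>c x y. \<lbrakk>x \<in> V; y \<in> V\<rbrakk> \<Longrightarrow> f x (s c y) = c * f x y"
  shows "bilinear_form_on s V f"
  using assms by (auto simp: bilinear_form_on_def linear_form_on_def)

lemma bilinear_form_onD:
  assumes "bilinear_form_on s V f"
  shows "\<lbrakk>x \<in> V; x' \<in> V; y \<in> V\<rbrakk> \<Longrightarrow> f (x + x') y = f x y + f x' y"
    and "\<lbrakk>x \<in> V; y \<in> V\<rbrakk> \<Longrightarrow> f (s c x) y = c * f x y"
    and "\<lbrakk>x \<in> V; y \<in> V; y' \<in> V\<rbrakk> \<Longrightarrow> f x (y + y') = f x y + f x y'"
    and "\<lbrakk>x \<in> V; y \<in> V\<rbrakk> \<Longrightarrow> f x (s c y) = c * f x y"
  using assms by (auto simp: bilinear_form_on_def linear_form_on_def)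

lemma linear_form_onD:
  assumes "linear_form_on s V f"
  shows "\<lbrakk>x \<in> V; x' \<in> V\<rbrakk> \<Longrightarrow> f (x + x') = f x + f x'"
    and "x \<in> V \<Longrightarrow> f (s c x) = c * f x"
  using assms by (auto simp: linear_form_on_def)

lemma bilinear_form_on_mult:
  assumes "linear_form_on s V \<phi>" "linear_form_on s V \<psi>"
  shows "bilinear_form_on s V (\<lambda>x y. \<phi> x * \<psi> y)"
  using assms by (auto simp: bilinear_form_on_def linear_form_on_def algebra_simps)

text \<open>
  Finite dimension is recorded by a finite family of vectors \<open>b\<^sub>i\<close> and forms \<open>e\<^sub>i\<close> with
  \<open>x = \<Sum>e\<^sub>i(x)b\<^sub>i\<close>, not necessarily a basis: interchanging the two families gives one for the dual.
\<close>

locale fd_space = vector_space s for s :: "'k::field \<Rightarrow> 'a::ab_group_add \<Rightarrow> 'a" +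
  fixes V :: "'a set"
  assumes subspace_V: "subspace V"
    and frame: "\<exists>n b e. (\<forall>i<n. b i \<in> V \<and> linear_form_on s V (e i)) \<and>
      (\<forall>x\<in>V. x = (\<Sum>i<(n::nat). s (e i x) (b i)))"
begin

lemma closed [simp]:
  "0 \<in> V" "\<lbrakk>x \<in> V; y \<in> V\<rbrakk> \<Longrightarrow> x + y \<in> V" "x \<in> V \<Longrightarrow> s c x \<in> V"
  using subspace_V by (auto simp: subspace_0 subspace_add subspace_scale)

lemma sum_closed: "(\<And>i. i \<in> I \<Longrightarrow> f i \<in> V) \<Longrightarrow> sum f I \<in> V"
  by (simp add: subspace_V subspace_sum)

lemma linear_form_sum:
  assumes "linear_form_on s V f" "\<And>i. i \<in> I \<Longrightarrow> x i \<in> V"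
  shows "f (\<Sum>i\<in>I. x i) = (\<Sum>i\<in>I. f (x i))"
proof -
  have "f (0 + 0) = f 0 + f 0"
    using assms(1) by (intro linear_form_onD) auto
  then have 0: "f 0 = 0" by (metis add.right_neutral add_left_cancel)
  show ?thesis
    using assms(2)
  proof (induction I rule: infinite_finite_induct)
    case (insert j I)
    then show ?case
      using linear_form_onD(1)[OF assms(1)] by (simp add: sum_closed)
  qed (auto simp: 0)
qed

lemma linear_form_frame:
  obtains n b e where "\<forall>i<n::nat. b i \<in> V \<and> linear_form_on s V (e i)"
    "\<forall>x\<in>V. x = (\<Sum>i<n. s (e i x) (b i))"
    "\<forall>f. linear_form_on s V f \<longrightarrow> (\<forall>x\<in>V. f x = (\<Sum>i<n. e i x * f (b i)))"
proof -
  from frame obtain n b e where *: "\<forall>i<n. b i \<in> V \<and> linear_form_on s V (e i)"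
    "\<forall>x\<in>V. x = (\<Sum>i<(n::nat). s (e i x) (b i))" by blast
  have "f x = (\<Sum>i<n. e i x * f (b i))" if f: "linear_form_on s V f" and x: "x \<in> V" for f x
  proof -
    have "f x = f (\<Sum>i<n. s (e i x) (b i))"
      using *(2) x by metis
    also have "\<dots> = (\<Sum>i<n. f (s (e i x) (b i)))"
      using *(1) f by (intro linear_form_sum) auto
    also have "\<dots> = (\<Sum>i<n. e i x * f (b i))"
      using *(1) f by (intro sum.cong) (auto simp: linear_form_onD)
    finally show ?thesis .
  qed
  with * show ?thesis using that by blast
qed

lemma linear_forms_separate:
  assumes "x \<in> V" "y \<in> V" "\<And>f. linear_form_on s V f \<Longrightarrow> f x = f y"
  shows "x = y"
proof -
  obtain n b e where *: "\<forall>i<n::nat. b i \<in> V \<and> linear_form_on s V (e i)"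
    "\<forall>x\<in>V. x = (\<Sum>i<n. s (e i x) (b i))"
    by (rule linear_form_frame) blast
  have "(\<Sum>i<n. s (e i x) (b i)) = (\<Sum>i<n. s (e i y) (b i))"
    by (intro sum.cong refl arg_cong2[of _ _ _ _ s] assms(3)) (use *(1) in auto)
  with *(2) assms(1,2) show ?thesis by metis
qed

lemma tensorE:
  assumes "t \<in> tensor_square s V"
  obtains n a b where "\<forall>i<n::nat. a i \<in> V \<and> b i \<in> V"
    "t = (\<lambda>f. if bilinear_form_on s V f then \<Sum>i<n. f (a i) (b i) else 0)"
proof -
  have "\<exists>n a b. (\<forall>i<n::nat. a i \<in> V \<and> b i \<in> V) \<and>
    t = (\<lambda>f. if bilinear_form_on s V f then \<Sum>i<n. f (a i) (b i) else 0)"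
    using assms unfolding tensor_square_def
  proof (induction rule: fun_scale.span_induct_alt)
    case base
    show ?case by (rule exI[of _ 0]) (auto simp: fun_eq_iff)
  next
    case (step c u t)
    from step(1) obtain x y where u: "u = pure_tensor2 s V x y" "x \<in> V" "y \<in> V" by auto
    from step(2) obtain n a b where t: "\<forall>i<n::nat. a i \<in> V \<and> b i \<in> V"
      "t = (\<lambda>f. if bilinear_form_on s V f then \<Sum>i<n. f (a i) (b i) else 0)" by auto
    \<comment> \<open>The scalar is absorbed into the left factor of the new pure tensor, which is
      placed at index \<open>0\<close>; \<open>case_nat\<close> shifts the old summands up by
      one.\<close>
    show ?case
      by (rule exI[of _ "Suc n"], rule exI[of _ "case_nat (s c x) a"],
          rule exI[of _ "case_nat y b"])
        (use t u in \<open>auto simp: fun_eq_iff fun_scale_def pure_tensor2_def sum.lessThan_Suc_shift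
          bilinear_form_onD split: nat.split simp del: sum.lessThan_Suc\<close>)
  qed
  then show ?thesis using that by blast
qed

text \<open>Coefficients are kept here because the coproduct of the dual will be written down with
  explicit ones, namely values of a form on products of frame vectors.\<close>

lemma tensorI:
  assumes "\<And>i. i \<in> I \<Longrightarrow> a i \<in> V" "\<And>i. i \<in> I \<Longrightarrow> b i \<in> V"
  shows "(\<lambda>f. if bilinear_form_on s V f then \<Sum>i\<in>I. c i * f (a i) (b i) else 0)
    \<in> tensor_square s V"
proof -
  have "(\<lambda>f. if bilinear_form_on s V f then \<Sum>i\<in>I. c i * f (a i) (b i) else 0)
    = (\<Sum>i\<in>I. fun_scale (c i) (pure_tensor2 s V (a i) (b i)))"
    by (auto simp: fun_eq_iff sum_fun_apply fun_scale_def pure_tensor2_def)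
  also have "\<dots> \<in> tensor_square s V"
    using assms unfolding tensor_square_def
    by (intro fun_scale.span_sum fun_scale.span_scale fun_scale.span_base) auto
  finally show ?thesis .
qed

lemma tensor_not_bilinear:
  "\<lbrakk>t \<in> tensor_square s V; \<not> bilinear_form_on s V f\<rbrakk> \<Longrightarrow> t f = 0"
  by (erule tensorE) auto

text \<open>Functions that agree on \<open>V\<close> are bilinear on \<open>V\<close> together, so
  the default value \<open>0\<close> causes no discrepancy. Algebra laws that hold only on the
  carrier can thus be applied under a tensor.\<close>

lemma tensor_cong:
  assumes "t \<in> tensor_square s V" "\<And>x y. \<lbrakk>x \<in> V; y \<in> V\<rbrakk> \<Longrightarrow> f x y = g x y"
  shows "t f = t g"
proof -
  have "bilinear_form_on s V f \<longleftrightarrow> bilinear_form_on s V g"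
    using assms(2) by (auto simp: bilinear_form_on_def linear_form_on_def)
  with assms show ?thesis
    by (elim tensorE) auto
qed

lemma tensor_sum:
  assumes "t \<in> tensor_square s V" "\<And>i. i \<in> I \<Longrightarrow> bilinear_form_on s V (f i)"
  shows "t (\<lambda>x y. \<Sum>i\<in>I. f i x y) = (\<Sum>i\<in>I. t (f i))"
proof -
  have "bilinear_form_on s V (\<lambda>x y. \<Sum>i\<in>I. f i x y)"
    by (rule bilinear_form_onI)
      (simp_all add: bilinear_form_onD[OF assms(2)] sum.distrib sum_distrib_left)
  with assms show ?thesis
    by (elim tensorE) (auto intro: sum.swap)
qed

lemma tensor_scale:
  assumes "t \<in> tensor_square s V" "bilinear_form_on s V f"
  shows "t (\<lambda>x y. c * f x y) = c * t f"
proof -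
  have "bilinear_form_on s V (\<lambda>x y. c * f x y)"
    using assms(2) by (auto intro!: bilinear_form_onI simp: bilinear_form_onD algebra_simps)
  with assms show ?thesis
    by (elim tensorE) (auto simp: sum_distrib_left)
qed

text \<open>Over a decomposition of \<open>t\<close> into pure tensors, the contraction is a finite
  sum of forms in \<open>w\<close>. The parameter has a space of its own because it may run through
  the dual. Nested contractions are shown to be multilinear in this way.\<close>

lemma linear_form_tensor:
  assumes W: "fd_space s' W" and t: "t \<in> tensor_square s V"
    and F: "\<And>w. w \<in> W \<Longrightarrow> bilinear_form_on s V (F w)"
    and lin: "\<And>x y. \<lbrakk>x \<in> V; y \<in> V\<rbrakk> \<Longrightarrow> linear_form_on s' W (\<lambda>w. F w x y)"
  shows "linear_form_on s' W (\<lambda>w. t (F w))"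
proof -
  interpret W: fd_space s' W by (rule W)
  from t obtain n a b where *: "\<forall>i<n::nat. a i \<in> V \<and> b i \<in> V"
    "t = (\<lambda>f. if bilinear_form_on s V f then \<Sum>i<n. f (a i) (b i) else 0)"
    by (rule tensorE) blast
  show ?thesis
    using * F linear_form_onD[OF lin]
    by (auto simp: linear_form_on_def sum_distrib_left simp flip: sum.distrib)
qed

text \<open>Both tensors become finite sums, and the sums are swapped. The two hypotheses on
  \<open>F\<close> ensure that inner and outer contractions evaluate bilinear forms and do not fall
  back to \<open>0\<close>. The spaces may differ, since a coproduct in \<open>A\<close> is later
  interchanged with one in the dual.\<close>

lemma tensor_fubini:
  assumes W: "fd_space s' W"
    and t: "t \<in> tensor_square s V" and u: "u \<in> tensor_square s' W"
    and F: "\<And>x y. \<lbrakk>x \<in> V; y \<in> V\<rbrakk> \<Longrightarrow> bilinear_form_on s' W (F x y)"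
    and F': "\<And>z w. \<lbrakk>z \<in> W; w \<in> W\<rbrakk> \<Longrightarrow> bilinear_form_on s V (\<lambda>x y. F x y z w)"
  shows "t (\<lambda>x y. u (F x y)) = u (\<lambda>z w. t (\<lambda>x y. F x y z w))"
proof -
  interpret W: fd_space s' W by (rule W)
  from t obtain n a b where 1: "\<forall>i<n::nat. a i \<in> V \<and> b i \<in> V"
    "t = (\<lambda>f. if bilinear_form_on s V f then \<Sum>i<n. f (a i) (b i) else 0)"
    by (rule tensorE) blast
  from u obtain m c d where 2: "\<forall>i<m::nat. c i \<in> W \<and> d i \<in> W"
    "u = (\<lambda>f. if bilinear_form_on s' W f then \<Sum>i<m. f (c i) (d i) else 0)"
    by (rule W.tensorE) blast
  have bil: "bilinear_form_on s V (\<lambda>x y. u (F x y))"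
    unfolding bilinear_form_on_def
    by (intro conjI ballI W.linear_form_tensor[OF fd_space_axioms u] F; simp?)
      (use F' in \<open>auto simp: bilinear_form_on_def\<close>)
  have bil': "bilinear_form_on s' W (\<lambda>z w. t (\<lambda>x y. F x y z w))"
    unfolding bilinear_form_on_def
    by (intro conjI ballI linear_form_tensor[OF W t] F'; simp?)
      (use F in \<open>auto simp: bilinear_form_on_def\<close>)
  have "t (\<lambda>x y. u (F x y)) = (\<Sum>i<n. u (F (a i) (b i)))"
    using bil 1(2) by simp
  also have "\<dots> = (\<Sum>i<n. \<Sum>j<m. F (a i) (b i) (c j) (d j))"
    using 1 2(2) F by simp
  also have "\<dots> = (\<Sum>j<m. \<Sum>i<n. F (a i) (b i) (c j) (d j))"
    by (rule sum.swap)
  also have "\<dots> = (\<Sum>j<m. t (\<lambda>x y. F x y (c j) (d j)))"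
    using 2 1(2) F' by simp
  also have "\<dots> = u (\<lambda>z w. t (\<lambda>x y. F x y z w))"
    using bil' 2(2) by simp
  finally show ?thesis .
qed

text \<open>Existence comes from summing \<open>F\<close> over a decomposition of \<open>t\<close>,
  uniqueness from the separation of vectors by forms. Together they license the definite description
  in \<open>tlift\<close>.\<close>

lemma bilinear_lift_unique:
  assumes t: "t \<in> tensor_square s V"
    and closed: "\<And>x y. \<lbrakk>x \<in> V; y \<in> V\<rbrakk> \<Longrightarrow> F x y \<in> V"
    and F: "\<And>\<psi>. linear_form_on s V \<psi> \<Longrightarrow> bilinear_form_on s V (\<lambda>x y. \<psi> (F x y))"
  shows "\<exists>!v. v \<in> V \<and> (\<forall>\<psi>. linear_form_on s V \<psi> \<longrightarrow> \<psi> v = t (\<lambda>x y. \<psi> (F x y)))"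
proof (rule ex_ex1I)
  from t obtain n a b where *: "\<forall>i<n::nat. a i \<in> V \<and> b i \<in> V"
    "t = (\<lambda>f. if bilinear_form_on s V f then \<Sum>i<n. f (a i) (b i) else 0)"
    by (rule tensorE) blast
  show "\<exists>v. v \<in> V \<and> (\<forall>\<psi>. linear_form_on s V \<psi> \<longrightarrow> \<psi> v = t (\<lambda>x y. \<psi> (F x y)))"
    using * closed F
    by (intro exI[of _ "\<Sum>i<n. F (a i) (b i)"]) (auto intro!: linear_form_sum sum_closed)
qed (metis linear_forms_separate)

end

section \<open>The dual space\<close>

lemma dual_carrier_iff:
  "\<phi> \<in> dual_carrier A \<longleftrightarrow> linear_form_on (scal A) (carrier A) \<phi> \<and> (\<forall>x. x \<notin> carrier A \<longrightarrow> \<phi> x = 0)"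
  by (simp add: dual_carrier_def)

context weak_bialgebra
begin

sublocale sp: fd_space "scal A" "carrier A"
proof -
  interpret vector_space "scal A" by (rule vector_space)
  from finite_dimensional obtain C where C: "finite C" "span C = carrier A" by blast
  \<comment> \<open>A basis is extracted from the finite spanning set; its coordinate functions
    \<open>representation B\<close> become the forms of the frame.\<close>
  obtain B where B: "B \<subseteq> C" "independent B" "C \<subseteq> span B"
    using maximal_independent_subset by blast
  have span: "span B = carrier A"
    using B C by (metis span_mono span_span subset_antisym)
  have "finite B" using B C finite_subset by blast
  then obtain h where h: "bij_betw h {..<card B} B"
    using ex_bij_betw_nat_finite by (metis atLeast0LessThan)
  show "fd_space (scal A) (carrier A)"
  proof
    show "module.subspace (scal A) (carrier A)" by (rule subspace)
    have e: "linear_form_on (scal A) (carrier A) (\<lambda>x. representation B x (h i))" for i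
      using B span by (auto simp: linear_form_on_def representation_add representation_scale)
    have b: "h i \<in> carrier A" if "i < card B" for i
      using h that span span_superset[of B] by (auto simp: bij_betw_def)
    have x: "x = (\<Sum>i<card B. scal A (representation B x (h i)) (h i))" if "x \<in> carrier A" for x
    proof -
      have "x = (\<Sum>b\<in>B. scal A (representation B x b) b)"
        by (rule sum_representation_eq[symmetric]) (use that B(2) span \<open>finite B\<close> in simp_all)
      also have "\<dots> = (\<Sum>i<card B. scal A (representation B x (h i)) (h i))"
        using sum.reindex_bij_betw[OF h, of "\<lambda>b. scal A (representation B x b) b"] by simp
      finally show ?thesis .
    qed
    show "\<exists>n b e. (\<forall>i<n. b i \<in> carrier A \<and> linear_form_on (scal A) (carrier A) (e i)) \<and>
      (\<forall>x\<in>carrier A. x = (\<Sum>i<(n::nat). scal A (e i x) (b i)))"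
      by (intro exI[of _ "card B"] exI[of _ h] exI[of _ "\<lambda>i x. representation B x (h i)"]
          conjI allI impI ballI b e x)
  qed
qed

text \<open>The coordinate forms are cut off to \<open>0\<close> outside the carrier, which makes
  them members of \<open>dual_carrier A\<close>. The last clause is the frame of the dual: its
  vectors are the \<open>e\<^sub>i\<close>, its coordinates the evaluations at
  \<open>b\<^sub>i\<close>.\<close>

lemma dual_frame:
  obtains n b e where "\<forall>i<n::nat. b i \<in> carrier A \<and> e i \<in> dual_carrier A"
    "\<forall>f. linear_form_on (scal A) (carrier A) f \<longrightarrow>
      (\<forall>x\<in>carrier A. f x = (\<Sum>i<n. e i x * f (b i)))"
    "\<forall>\<phi>\<in>dual_carrier A. \<phi> = (\<Sum>i<n. fun_scale (\<phi> (b i)) (e i))"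
proof -
  obtain n b e where *: "\<forall>i<n::nat. b i \<in> carrier A \<and> linear_form_on (scal A) (carrier A) (e i)"
    "\<forall>f. linear_form_on (scal A) (carrier A) f \<longrightarrow>
      (\<forall>x\<in>carrier A. f x = (\<Sum>i<n. e i x * f (b i)))"
    by (rule sp.linear_form_frame)
  define e' where "e' i x = (if x \<in> carrier A then e i x else 0)" for i x
  have "\<forall>i<n. b i \<in> carrier A \<and> e' i \<in> dual_carrier A"
    using *(1) by (auto simp: dual_carrier_iff linear_form_on_def e'_def)
  moreover have "\<phi> = (\<Sum>i<n. fun_scale (\<phi> (b i)) (e' i))" if \<phi>: "\<phi> \<in> dual_carrier A" for \<phi>
  proof
    fix x
    show "\<phi> x = (\<Sum>i<n. fun_scale (\<phi> (b i)) (e' i)) x"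
    proof (cases "x \<in> carrier A")
      case True
      then have "\<phi> x = (\<Sum>i<n. e i x * \<phi> (b i))"
        using *(2) \<phi> dual_carrier_iff by blast
      with True show ?thesis
        by (simp add: sum_fun_apply fun_scale_def e'_def mult.commute)
    qed (use \<phi> in \<open>simp add: sum_fun_apply fun_scale_def e'_def dual_carrier_iff\<close>)
  qed
  moreover have "f x = (\<Sum>i<n. e' i x * f (b i))"
    if "x \<in> carrier A" "linear_form_on (scal A) (carrier A) f" for x f
    unfolding e'_def if_P[OF that(1)] using *(2) that by blast
  ultimately show ?thesis
    using that by blast
qed

lemma linear_form_eval: "linear_form_on fun_scale (dual_carrier A) (\<lambda>\<phi>. \<phi> x)"
  by (auto simp: linear_form_on_def fun_scale_def)

sublocale du: fd_space fun_scale "dual_carrier A"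
proof
  show "module.subspace fun_scale (dual_carrier A)"
    by (auto simp: fun_scale.subspace_def dual_carrier_iff linear_form_on_def fun_scale_def algebra_simps)
  obtain n b e where *: "\<forall>i<n::nat. b i \<in> carrier A \<and> e i \<in> dual_carrier A"
    "\<forall>\<phi>\<in>dual_carrier A. \<phi> = (\<Sum>i<n. fun_scale (\<phi> (b i)) (e i))"
    by (rule dual_frame)
  then show "\<exists>n b e. (\<forall>i<n. b i \<in> dual_carrier A \<and> linear_form_on fun_scale (dual_carrier A) (e i)) \<and>
      (\<forall>\<phi>\<in>dual_carrier A. \<phi> = (\<Sum>i<(n::nat). fun_scale (e i \<phi>) (b i)))"
    by (intro exI[of _ n] exI[of _ e] exI[of _ "\<lambda>i \<phi>. \<phi> (b i)"]) (use linear_form_eval in blast)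
qed

section \<open>Evaluation of the structure maps\<close>

declare mult_closed [simp] unit_closed [simp] unit_left [simp] unit_right [simp]
  comult_closed [simp] mult_add_left [simp] mult_add_right [simp]
  mult_scal_left [simp] mult_scal_right [simp]

lemmas multilinear_defs = linear_form_on_def bilinear_form_on_def trilinear_form_on_def

lemmas counit_simps [simp] = linear_form_onD[OF counit_linear]

lemma linear_form_comult: "linear_form_on (scal A) (carrier A) (\<lambda>a. \<Delta> a f)"
  by (simp add: linear_form_on_def comult_add comult_scal fun_scale_def)

lemmas unit_tensor = comult_closed[OF unit_closed]
lemmas unit_tensor_cong = sp.tensor_cong[OF unit_tensor]
lemmas linear_form_tensor = sp.linear_form_tensor[OF sp.fd_space_axioms]
lemmas linear_form_unit_tensor = linear_form_tensor[OF unit_tensor]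
lemmas tensor_fubini = sp.tensor_fubini[OF sp.fd_space_axioms]

lemma tlift_eval:
  assumes "t \<in> tensor_square (scal A) (carrier A)"
    and "\<And>x y. \<lbrakk>x \<in> carrier A; y \<in> carrier A\<rbrakk> \<Longrightarrow> F x y \<in> carrier A"
    and "\<And>\<psi>. linear_form_on (scal A) (carrier A) \<psi> \<Longrightarrow> bilin A (\<lambda>x y. \<psi> (F x y))"
  shows "tlift A F t \<in> carrier A"
    and "linear_form_on (scal A) (carrier A) \<psi> \<Longrightarrow> \<psi> (tlift A F t) = t (\<lambda>x y. \<psi> (F x y))"
  using theI'[OF sp.bilinear_lift_unique[where F = F, OF assms]] by (auto simp: tlift_def)

lemma bilin_scal:
  assumes "linear_form_on (scal A) (carrier A) \<phi>" "linear_form_on (scal A) (carrier A) \<psi>"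
  shows "bilin A (\<lambda>x y. \<psi> (scal A (\<phi> x) y))" "bilin A (\<lambda>x y. \<psi> (scal A (\<phi> y) x))"
  using assms by (auto simp: multilinear_defs algebra_simps)

lemma tlift_scal_left:
  assumes t: "t \<in> tensor_square (scal A) (carrier A)"
    and \<phi>: "linear_form_on (scal A) (carrier A) \<phi>"
  shows "tlift A (\<lambda>x y. scal A (\<phi> x) y) t \<in> carrier A"
    and "linear_form_on (scal A) (carrier A) \<psi>
      \<Longrightarrow> \<psi> (tlift A (\<lambda>x y. scal A (\<phi> x) y) t) = t (\<lambda>x y. \<phi> x * \<psi> y)"
proof -
  show "tlift A (\<lambda>x y. scal A (\<phi> x) y) t \<in> carrier A"
    by (rule tlift_eval(1)[OF t]) (auto intro: bilin_scal[OF \<phi>])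
  assume \<psi>: "linear_form_on (scal A) (carrier A) \<psi>"
  have "\<psi> (tlift A (\<lambda>x y. scal A (\<phi> x) y) t) = t (\<lambda>x y. \<psi> (scal A (\<phi> x) y))"
    by (rule tlift_eval(2)[OF t _ _ \<psi>]) (auto intro: bilin_scal[OF \<phi>])
  also have "\<dots> = t (\<lambda>x y. \<phi> x * \<psi> y)"
    by (rule sp.tensor_cong[OF t]) (simp add: linear_form_onD[OF \<psi>])
  finally show "\<psi> (tlift A (\<lambda>x y. scal A (\<phi> x) y) t) = t (\<lambda>x y. \<phi> x * \<psi> y)" .
qed

lemma tlift_scal_right:
  assumes t: "t \<in> tensor_square (scal A) (carrier A)"
    and \<phi>: "linear_form_on (scal A) (carrier A) \<phi>"
  shows "tlift A (\<lambda>x y. scal A (\<phi> y) x) t \<in> carrier A"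
    and "linear_form_on (scal A) (carrier A) \<psi>
      \<Longrightarrow> \<psi> (tlift A (\<lambda>x y. scal A (\<phi> y) x) t) = t (\<lambda>x y. \<psi> x * \<phi> y)"
proof -
  show "tlift A (\<lambda>x y. scal A (\<phi> y) x) t \<in> carrier A"
    by (rule tlift_eval(1)[OF t]) (auto intro: bilin_scal[OF \<phi>])
  assume \<psi>: "linear_form_on (scal A) (carrier A) \<psi>"
  have "\<psi> (tlift A (\<lambda>x y. scal A (\<phi> y) x) t) = t (\<lambda>x y. \<psi> (scal A (\<phi> y) x))"
    by (rule tlift_eval(2)[OF t _ _ \<psi>]) (auto intro: bilin_scal[OF \<phi>])
  also have "\<dots> = t (\<lambda>x y. \<psi> x * \<phi> y)"
    by (rule sp.tensor_cong[OF t]) (simp add: linear_form_onD[OF \<psi>])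
  finally show "\<psi> (tlift A (\<lambda>x y. scal A (\<phi> y) x) t) = t (\<lambda>x y. \<psi> x * \<phi> y)" .
qed

lemma counit_left_eval:
  assumes "a \<in> carrier A" "linear_form_on (scal A) (carrier A) \<psi>"
  shows "\<Delta> a (\<lambda>x y. \<epsilon> x * \<psi> y) = \<psi> a"
  using tlift_scal_left(2)[OF comult_closed counit_linear assms(2)] counit_left assms(1) by simp

lemma counit_right_eval:
  assumes "a \<in> carrier A" "linear_form_on (scal A) (carrier A) \<psi>"
  shows "\<Delta> a (\<lambda>x y. \<psi> x * \<epsilon> y) = \<psi> a"
  using tlift_scal_right(2)[OF comult_closed counit_linear assms(2)] counit_right assms(1) by simp

lemma comult_mult_eval:
  assumes "a \<in> carrier A" "b \<in> carrier A" "bilin A f"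
  shows "\<Delta> (a \<cdot> b) f = \<Delta> a (\<lambda>x y. \<Delta> b (\<lambda>z w. f (x \<cdot> z) (y \<cdot> w)))"
  using assms by (simp add: comult_mult tmult2_def)

lemma coassoc_eval:
  assumes "a \<in> carrier A" "trilin A f"
  shows "\<Delta> a (\<lambda>b z. \<Delta> b (\<lambda>x y. f x y z)) = \<Delta> a (\<lambda>x b. \<Delta> b (f x))"
  using fun_cong[OF coassoc[OF assms(1)], of f] assms(2)
  by (simp add: comult_left_def comult_right_def)

lemma dual_carrierD: "\<phi> \<in> dual_carrier A \<Longrightarrow> linear_form_on (scal A) (carrier A) \<phi>"
  by (simp add: dual_carrier_iff)

lemma carrier_dual: "carrier (dual A) = dual_carrier A"
  by (simp add: dual_def)

lemma eps_closed:
  assumes "a \<in> carrier A"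
  shows "eps A \<sigma> a \<in> dual_carrier A"
  using assms by (cases \<sigma>) (auto simp: dual_carrier_iff multilinear_defs)

lemma eps_hat_L:
  assumes "\<phi> \<in> dual_carrier A"
  shows "eps_hat A L \<phi> \<in> carrier A"
    and "linear_form_on (scal A) (carrier A) \<psi> \<Longrightarrow> \<psi> (eps_hat A L \<phi>) = \<Delta> \<one> (\<lambda>x y. \<phi> x * \<psi> y)"
  using tlift_scal_left[OF comult_closed dual_carrierD[OF assms]] by simp_all

lemma eps_hat_R:
  assumes "\<phi> \<in> dual_carrier A"
  shows "eps_hat A R \<phi> \<in> carrier A"
    and "linear_form_on (scal A) (carrier A) \<psi> \<Longrightarrow> \<psi> (eps_hat A R \<phi>) = \<Delta> \<one> (\<lambda>x y. \<psi> x * \<phi> y)"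
  using tlift_scal_right[OF comult_closed dual_carrierD[OF assms]] by simp_all

lemma eps_hat_closed: "\<phi> \<in> dual_carrier A \<Longrightarrow> eps_hat A \<sigma> \<phi> \<in> carrier A"
  using eps_hat_L(1) eps_hat_R(1) by (cases \<sigma>) auto

lemma N_LL_iff:
  "a \<in> N L L A \<longleftrightarrow> a \<in> carrier A \<and> (\<forall>f. bilin A f \<longrightarrow> \<Delta> a f = \<Delta> \<one> (\<lambda>x y. f (a \<cdot> x) y))"
  by (auto simp: fun_eq_iff tmap_def sp.tensor_not_bilinear)

lemma N_RR_iff:
  "a \<in> N R R A \<longleftrightarrow> a \<in> carrier A \<and> (\<forall>f. bilin A f \<longrightarrow> \<Delta> a f = \<Delta> \<one> (\<lambda>x y. f x (y \<cdot> a)))"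
  by (auto simp: fun_eq_iff tmap_def sp.tensor_not_bilinear)

section \<open>Comonoidality\<close>

text \<open>The units in the outer legs cancel, and only the middle legs multiply. Coassociativity
  moves the iterated coproduct into the second leg, so that the first leg is free to be contracted
  with a form.\<close>

lemma left_comonoidal_iff:
  "left_comonoidal A \<longleftrightarrow> (\<forall>f. trilin A f \<longrightarrow>
    \<Delta> \<one> (\<lambda>x y. \<Delta> \<one> (\<lambda>z w. f x (y \<cdot> z) w)) = \<Delta> \<one> (\<lambda>x a. \<Delta> a (f x)))"
proof -
  let ?t = "tmult3 A (tensor21 A (\<Delta> \<one>) \<one>) (tensor12 A \<one> (\<Delta> \<one>))"
  have eval: "?t f = \<Delta> \<one> (\<lambda>x y. \<Delta> \<one> (\<lambda>z w. f x (y \<cdot> z) w))" if f: "trilin A f" for f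
  proof -
    \<comment> \<open>Both embeddings of \<open>\<Delta>(1)\<close> test trilinearity before
      evaluating. \<open>G\<close> hides the inner test, which is resolved for arguments in the
      carrier; trilinearity looks at no others, so it transfers from the explicit formula to
      \<open>G\<close>.\<close>
    define G where "G a b c = tensor12 A \<one> (\<Delta> \<one>) (\<lambda>x y z. f (a \<cdot> x) (b \<cdot> y) (c \<cdot> z))" for a b c
    have G: "G a b c = \<Delta> \<one> (\<lambda>y z. f a (b \<cdot> y) (c \<cdot> z))"
      if "a \<in> carrier A" "b \<in> carrier A" "c \<in> carrier A" for a b c
    proof -
      have "trilin A (\<lambda>x y z. f (a \<cdot> x) (b \<cdot> y) (c \<cdot> z))"
        using f that by (auto simp: multilinear_defs)
      then show ?thesis using that by (simp add: G_def tensor12_def)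
    qed
    have "trilin A (\<lambda>a b c. \<Delta> \<one> (\<lambda>y z. f a (b \<cdot> y) (c \<cdot> z)))"
      unfolding trilinear_form_on_def
      by (intro conjI ballI linear_form_unit_tensor)
        (use f in \<open>auto simp: multilinear_defs\<close>)
    then have "trilin A G"
      by (auto simp: multilinear_defs G)
    then have "?t f = \<Delta> \<one> (\<lambda>x y. G x y \<one>)"
      using f by (simp add: tmult3_def tensor21_def flip: G_def)
    also have "\<dots> = \<Delta> \<one> (\<lambda>x y. \<Delta> \<one> (\<lambda>z w. f x (y \<cdot> z) (\<one> \<cdot> w)))"
      by (rule unit_tensor_cong) (auto simp: G)
    also have "\<dots> = \<Delta> \<one> (\<lambda>x y. \<Delta> \<one> (\<lambda>z w. f x (y \<cdot> z) w))"
      by (intro unit_tensor_cong) auto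
    finally show ?thesis .
  qed
  have "?t f = comult_left A (\<Delta> \<one>) f \<longleftrightarrow> (trilin A f \<longrightarrow>
    \<Delta> \<one> (\<lambda>x y. \<Delta> \<one> (\<lambda>z w. f x (y \<cdot> z) w)) = \<Delta> \<one> (\<lambda>x a. \<Delta> a (f x)))" for f
  proof (cases "trilin A f")
    case True
    then have "comult_left A (\<Delta> \<one>) f = \<Delta> \<one> (\<lambda>x a. \<Delta> a (f x))"
      by (simp add: comult_left_def coassoc_eval)
    with eval[OF True] True show ?thesis by simp
  qed (simp add: tmult3_def comult_left_def)
  then show ?thesis
    by (simp only: left_comonoidal_def fun_eq_iff)
qed

lemma right_comonoidal_iff:
  "right_comonoidal A \<longleftrightarrow> (\<forall>f. trilin A f \<longrightarrow>
    \<Delta> \<one> (\<lambda>x y. \<Delta> \<one> (\<lambda>z w. f x (z \<cdot> y) w)) = \<Delta> \<one> (\<lambda>x a. \<Delta> a (f x)))"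
proof -
  let ?t = "tmult3 A (tensor12 A \<one> (\<Delta> \<one>)) (tensor21 A (\<Delta> \<one>) \<one>)"
  have eval: "?t f = \<Delta> \<one> (\<lambda>x y. \<Delta> \<one> (\<lambda>z w. f x (z \<cdot> y) w))" if f: "trilin A f" for f
  proof -
    define G where "G a b c = tensor21 A (\<Delta> \<one>) \<one> (\<lambda>x y z. f (a \<cdot> x) (b \<cdot> y) (c \<cdot> z))" for a b c
    have G: "G a b c = \<Delta> \<one> (\<lambda>x y. f (a \<cdot> x) (b \<cdot> y) c)"
      if "a \<in> carrier A" "b \<in> carrier A" "c \<in> carrier A" for a b c
    proof -
      have "trilin A (\<lambda>x y z. f (a \<cdot> x) (b \<cdot> y) (c \<cdot> z))"
        using f that by (auto simp: multilinear_defs)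
      then show ?thesis using that by (simp add: G_def tensor21_def)
    qed
    have "trilin A (\<lambda>a b c. \<Delta> \<one> (\<lambda>x y. f (a \<cdot> x) (b \<cdot> y) c))"
      unfolding trilinear_form_on_def
      by (intro conjI ballI linear_form_unit_tensor)
        (use f in \<open>auto simp: multilinear_defs\<close>)
    then have "trilin A G"
      by (auto simp: multilinear_defs G)
    then have "?t f = \<Delta> \<one> (\<lambda>z w. G \<one> z w)"
      using f by (simp add: tmult3_def tensor12_def flip: G_def)
    also have "\<dots> = \<Delta> \<one> (\<lambda>z w. \<Delta> \<one> (\<lambda>x y. f (\<one> \<cdot> x) (z \<cdot> y) w))"
      by (rule unit_tensor_cong) (auto simp: G)
    also have "\<dots> = \<Delta> \<one> (\<lambda>z w. \<Delta> \<one> (\<lambda>x y. f x (z \<cdot> y) w))"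
      by (intro unit_tensor_cong) auto
    \<comment> \<open>Interchanging the two copies of \<open>\<Delta>(1)\<close> leaves a criterion
      that differs from the left-handed one only in the order of \<open>z\<close> and
      \<open>y\<close>, so for the opposite algebra the two coincide literally.\<close>
    also have "\<dots> = \<Delta> \<one> (\<lambda>x y. \<Delta> \<one> (\<lambda>z w. f x (z \<cdot> y) w))"
      by (rule tensor_fubini[OF unit_tensor unit_tensor])
        (use f in \<open>auto simp: multilinear_defs\<close>)
    finally show ?thesis .
  qed
  have "?t f = comult_left A (\<Delta> \<one>) f \<longleftrightarrow> (trilin A f \<longrightarrow>
    \<Delta> \<one> (\<lambda>x y. \<Delta> \<one> (\<lambda>z w. f x (z \<cdot> y) w)) = \<Delta> \<one> (\<lambda>x a. \<Delta> a (f x)))" for f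
  proof (cases "trilin A f")
    case True
    then have "comult_left A (\<Delta> \<one>) f = \<Delta> \<one> (\<lambda>x a. \<Delta> a (f x))"
      by (simp add: comult_left_def coassoc_eval)
    with eval[OF True] True show ?thesis by simp
  qed (simp add: tmult3_def comult_left_def)
  then show ?thesis
    by (simp only: right_comonoidal_def fun_eq_iff)
qed

text \<open>Along the frame, a bilinear form \<open>K\<close> is the sum of the products
  \<open>e\<^sub>i(x) K(b\<^sub>i, y)\<close>. Agreement can therefore be tested after splitting off
  a form in the first variable and freezing the first argument of \<open>H\<close>. For
  \<open>t = \<Delta>(1)\<close> the contraction with \<open>\<phi>\<close> produces an element of
  \<open>A\<^sub>L\<close>.\<close>

lemma tensor_eqI_left:
  assumes t: "t \<in> tensor_square (scal A) (carrier A)" and H: "bilin A H" "bilin A H'"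
    and eq: "\<And>\<phi> c. \<lbrakk>\<phi> \<in> dual_carrier A; c \<in> carrier A\<rbrakk>
      \<Longrightarrow> t (\<lambda>x y. \<phi> x * H c y) = t (\<lambda>x y. \<phi> x * H' c y)"
  shows "t H = t H'"
proof -
  obtain n b e where *: "\<forall>i<n::nat. b i \<in> carrier A \<and> e i \<in> dual_carrier A"
    "\<forall>f. linear_form_on (scal A) (carrier A) f \<longrightarrow>
      (\<forall>x\<in>carrier A. f x = (\<Sum>i<n. e i x * f (b i)))"
    by (rule dual_frame)
  have expand: "t K = (\<Sum>i<n. t (\<lambda>x y. e i x * K (b i) y))" if K: "bilin A K" for K
  proof -
    have "t K = t (\<lambda>x y. \<Sum>i<n. e i x * K (b i) y)"
      using *(2) K by (intro sp.tensor_cong[OF t]) (auto simp: bilinear_form_on_def)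
    also have "\<dots> = (\<Sum>i<n. t (\<lambda>x y. e i x * K (b i) y))"
      using *(1) K
      by (intro sp.tensor_sum[OF t] bilinear_form_on_mult) (auto simp: dual_carrierD bilinear_form_on_def)
    finally show ?thesis .
  qed
  show ?thesis
    unfolding expand[OF H(1)] expand[OF H(2)] using * by (intro sum.cong eq) auto
qed

lemma tensor_eqI_right:
  assumes t: "t \<in> tensor_square (scal A) (carrier A)" and H: "bilin A H" "bilin A H'"
    and eq: "\<And>\<phi> c. \<lbrakk>\<phi> \<in> dual_carrier A; c \<in> carrier A\<rbrakk>
      \<Longrightarrow> t (\<lambda>x y. H x c * \<phi> y) = t (\<lambda>x y. H' x c * \<phi> y)"
  shows "t H = t H'"
proof -
  obtain n b e where *: "\<forall>i<n::nat. b i \<in> carrier A \<and> e i \<in> dual_carrier A"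
    "\<forall>f. linear_form_on (scal A) (carrier A) f \<longrightarrow>
      (\<forall>x\<in>carrier A. f x = (\<Sum>i<n. e i x * f (b i)))"
    by (rule dual_frame)
  have expand: "t K = (\<Sum>i<n. t (\<lambda>x y. K x (b i) * e i y))" if K: "bilin A K" for K
  proof -
    have "t K = t (\<lambda>x y. \<Sum>i<n. K x (b i) * e i y)"
      using *(2) K by (intro sp.tensor_cong[OF t]) (auto simp: bilinear_form_on_def mult.commute)
    also have "\<dots> = (\<Sum>i<n. t (\<lambda>x y. K x (b i) * e i y))"
      using *(1) K
      by (intro sp.tensor_sum[OF t] bilinear_form_on_mult) (auto simp: dual_carrierD bilinear_form_on_def)
    finally show ?thesis .
  qed
  show ?thesis
    unfolding expand[OF H(1)] expand[OF H(2)] using * by (intro sum.cong eq) auto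
qed

text \<open>These are the right-hand sides of the conditions defining \<open>N L L\<close> and
  \<open>N R R\<close>, read as forms in \<open>a\<close>. In this shape they can be evaluated at
  \<open>eps_hat\<close>, whose values are known under linear forms.\<close>

lemma linear_form_shift:
  assumes "bilin A f"
  shows "linear_form_on (scal A) (carrier A) (\<lambda>a. \<Delta> \<one> (\<lambda>x y. f (a \<cdot> x) y))"
    and "linear_form_on (scal A) (carrier A) (\<lambda>a. \<Delta> \<one> (\<lambda>x y. f x (y \<cdot> a)))"
  by (intro linear_form_unit_tensor; use assms in \<open>auto simp: multilinear_defs\<close>)+

lemma left_comonoidal_iff_L: "left_comonoidal A \<longleftrightarrow> range1 A L \<subseteq> N L L A"
proof
  assume lc: "left_comonoidal A"
  have "eps_hat A L \<phi> \<in> N L L A" if \<phi>: "\<phi> \<in> dual_carrier A" for \<phi>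
    unfolding N_LL_iff
  proof (intro conjI allI impI)
    fix g assume g: "bilin A g"
    \<comment> \<open>Comonoidality is tested on the product of \<open>\<phi>\<close> in the first
      leg and an arbitrary bilinear form in the other two.\<close>
    have "trilin A (\<lambda>a x y. \<phi> a * g x y)"
      using dual_carrierD[OF \<phi>] g by (auto simp: multilinear_defs algebra_simps)
    then have *: "\<Delta> \<one> (\<lambda>x y. \<Delta> \<one> (\<lambda>z w. \<phi> x * g (y \<cdot> z) w)) = \<Delta> \<one> (\<lambda>x a. \<Delta> a (\<lambda>y z. \<phi> x * g y z))"
      by (rule lc[unfolded left_comonoidal_iff, rule_format])
    have "\<Delta> (eps_hat A L \<phi>) g = \<Delta> \<one> (\<lambda>x a. \<phi> x * \<Delta> a g)"
      by (rule eps_hat_L(2)[OF \<phi> linear_form_comult])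
    also have "\<dots> = \<Delta> \<one> (\<lambda>x a. \<Delta> a (\<lambda>y z. \<phi> x * g y z))"
      by (rule unit_tensor_cong) (simp add: sp.tensor_scale g)
    also have "\<dots> = \<Delta> \<one> (\<lambda>x y. \<Delta> \<one> (\<lambda>z w. \<phi> x * g (y \<cdot> z) w))"
      by (rule *[symmetric])
    also have "\<dots> = \<Delta> \<one> (\<lambda>x y. \<phi> x * \<Delta> \<one> (\<lambda>z w. g (y \<cdot> z) w))"
      by (rule unit_tensor_cong, rule sp.tensor_scale)
        (use g in \<open>auto simp: multilinear_defs\<close>)
    also have "\<dots> = \<Delta> \<one> (\<lambda>z w. g (eps_hat A L \<phi> \<cdot> z) w)"
      by (rule eps_hat_L(2)[OF \<phi> linear_form_shift(1)[OF g], symmetric])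
    finally show "\<Delta> (eps_hat A L \<phi>) g = \<Delta> \<one> (\<lambda>z w. g (eps_hat A L \<phi> \<cdot> z) w)" .
  qed (rule eps_hat_L(1)[OF \<phi>])
  then show "range1 A L \<subseteq> N L L A"
    by (auto simp only: range1_def carrier_dual)
next
  assume sub: "range1 A L \<subseteq> N L L A"
  show "left_comonoidal A"
    unfolding left_comonoidal_iff
  proof (intro allI impI)
    fix f assume f: "trilin A f"
    have bil: "bilin A (f c)" if "c \<in> carrier A" for c
      using f that by (auto simp: multilinear_defs)
    show "\<Delta> \<one> (\<lambda>x y. \<Delta> \<one> (\<lambda>z w. f x (y \<cdot> z) w)) = \<Delta> \<one> (\<lambda>x a. \<Delta> a (f x))"
    proof (rule tensor_eqI_left[OF unit_tensor])
      show "bilin A (\<lambda>x y. \<Delta> \<one> (\<lambda>z w. f x (y \<cdot> z) w))"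
        unfolding bilinear_form_on_def
        by (intro conjI ballI linear_form_unit_tensor) (use f in \<open>auto simp: multilinear_defs\<close>)
      show "bilin A (\<lambda>x a. \<Delta> a (f x))"
        unfolding bilinear_form_on_def
        by (intro conjI ballI linear_form_comult linear_form_tensor[OF comult_closed])
          (use f in \<open>auto simp: multilinear_defs\<close>)
      fix \<phi> c assume \<phi>: "\<phi> \<in> dual_carrier A" and c: "c \<in> carrier A"
      have "eps_hat A L \<phi> \<in> N L L A"
        using sub \<phi> unfolding range1_def carrier_dual by blast
      then have N: "\<Delta> (eps_hat A L \<phi>) (f c) = \<Delta> \<one> (\<lambda>z w. f c (eps_hat A L \<phi> \<cdot> z) w)"
        using bil[OF c] by (simp only: N_LL_iff)
      have "\<Delta> \<one> (\<lambda>x y. \<phi> x * \<Delta> \<one> (\<lambda>z w. f c (y \<cdot> z) w)) = \<Delta> (eps_hat A L \<phi>) (f c)"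
        unfolding N by (rule eps_hat_L(2)[OF \<phi> linear_form_shift(1)[OF bil[OF c]], symmetric])
      also have "\<dots> = \<Delta> \<one> (\<lambda>x a. \<phi> x * \<Delta> a (f c))"
        by (rule eps_hat_L(2)[OF \<phi> linear_form_comult])
      finally show "\<Delta> \<one> (\<lambda>x y. \<phi> x * \<Delta> \<one> (\<lambda>z w. f c (y \<cdot> z) w)) = \<Delta> \<one> (\<lambda>x a. \<phi> x * \<Delta> a (f c))" .
    qed
  qed
qed

lemma left_comonoidal_iff_R: "left_comonoidal A \<longleftrightarrow> range1 A R \<subseteq> N R R A"
proof -
  \<comment> \<open>To free the third leg, the iterated coproduct is read as
    \<open>(\<Delta> \<otimes> id)\<Delta>(1)\<close>, and the copy of \<open>\<Delta>(1)\<close>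
    that supplies the third leg becomes the outer one.\<close>
  have iff: "left_comonoidal A \<longleftrightarrow> (\<forall>f. trilin A f \<longrightarrow>
    \<Delta> \<one> (\<lambda>z w. \<Delta> \<one> (\<lambda>x y. f x (y \<cdot> z) w)) = \<Delta> \<one> (\<lambda>a z. \<Delta> a (\<lambda>x y. f x y z)))"
  proof -
    have "\<Delta> \<one> (\<lambda>x y. \<Delta> \<one> (\<lambda>z w. f x (y \<cdot> z) w)) = \<Delta> \<one> (\<lambda>z w. \<Delta> \<one> (\<lambda>x y. f x (y \<cdot> z) w))"
      if "trilin A f" for f
      by (rule tensor_fubini[OF unit_tensor unit_tensor])
        (use that in \<open>auto simp: multilinear_defs\<close>)
    then show ?thesis
      unfolding left_comonoidal_iff by (simp add: coassoc_eval)
  qed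
  show ?thesis
  proof
    assume lc: "left_comonoidal A"
    have "eps_hat A R \<phi> \<in> N R R A" if \<phi>: "\<phi> \<in> dual_carrier A" for \<phi>
      unfolding N_RR_iff
    proof (intro conjI allI impI)
      fix g assume g: "bilin A g"
      have "trilin A (\<lambda>x y a. \<phi> a * g x y)"
        using dual_carrierD[OF \<phi>] g by (auto simp: multilinear_defs algebra_simps)
      then have *: "\<Delta> \<one> (\<lambda>z w. \<Delta> \<one> (\<lambda>x y. \<phi> w * g x (y \<cdot> z))) = \<Delta> \<one> (\<lambda>a z. \<Delta> a (\<lambda>x y. \<phi> z * g x y))"
        by (rule lc[unfolded iff, rule_format])
      have "\<Delta> (eps_hat A R \<phi>) g = \<Delta> \<one> (\<lambda>a z. \<Delta> a g * \<phi> z)"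
        by (rule eps_hat_R(2)[OF \<phi> linear_form_comult])
      also have "\<dots> = \<Delta> \<one> (\<lambda>a z. \<Delta> a (\<lambda>x y. \<phi> z * g x y))"
        by (rule unit_tensor_cong) (simp add: sp.tensor_scale g mult.commute)
      also have "\<dots> = \<Delta> \<one> (\<lambda>z w. \<Delta> \<one> (\<lambda>x y. \<phi> w * g x (y \<cdot> z)))"
        by (rule *[symmetric])
      also have "\<dots> = \<Delta> \<one> (\<lambda>z w. \<Delta> \<one> (\<lambda>x y. g x (y \<cdot> z)) * \<phi> w)"
        by (rule unit_tensor_cong, subst mult.commute, rule sp.tensor_scale)
          (use g in \<open>auto simp: multilinear_defs\<close>)
      also have "\<dots> = \<Delta> \<one> (\<lambda>x y. g x (y \<cdot> eps_hat A R \<phi>))"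
        by (rule eps_hat_R(2)[OF \<phi> linear_form_shift(2)[OF g], symmetric])
      finally show "\<Delta> (eps_hat A R \<phi>) g = \<Delta> \<one> (\<lambda>x y. g x (y \<cdot> eps_hat A R \<phi>))" .
    qed (rule eps_hat_R(1)[OF \<phi>])
    then show "range1 A R \<subseteq> N R R A"
      by (auto simp only: range1_def carrier_dual)
  next
    assume sub: "range1 A R \<subseteq> N R R A"
    show "left_comonoidal A"
      unfolding iff
    proof (intro allI impI)
      fix f assume f: "trilin A f"
      have bil: "bilin A (\<lambda>x y. f x y c)" if "c \<in> carrier A" for c
        using f that by (auto simp: multilinear_defs)
      show "\<Delta> \<one> (\<lambda>z w. \<Delta> \<one> (\<lambda>x y. f x (y \<cdot> z) w)) = \<Delta> \<one> (\<lambda>a z. \<Delta> a (\<lambda>x y. f x y z))"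
      proof (rule tensor_eqI_right[OF unit_tensor])
        show "bilin A (\<lambda>z w. \<Delta> \<one> (\<lambda>x y. f x (y \<cdot> z) w))"
          unfolding bilinear_form_on_def
          by (intro conjI ballI linear_form_unit_tensor) (use f in \<open>auto simp: multilinear_defs\<close>)
        show "bilin A (\<lambda>a z. \<Delta> a (\<lambda>x y. f x y z))"
          unfolding bilinear_form_on_def
          by (intro conjI ballI linear_form_comult linear_form_tensor[OF comult_closed])
            (use f in \<open>auto simp: multilinear_defs\<close>)
        fix \<phi> c assume \<phi>: "\<phi> \<in> dual_carrier A" and c: "c \<in> carrier A"
        have "eps_hat A R \<phi> \<in> N R R A"
          using sub \<phi> unfolding range1_def carrier_dual by blast
        then have N: "\<Delta> (eps_hat A R \<phi>) (\<lambda>x y. f x y c) = \<Delta> \<one> (\<lambda>x y. f x (y \<cdot> eps_hat A R \<phi>) c)"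
          using bil[OF c] by (simp only: N_RR_iff)
        have "\<Delta> \<one> (\<lambda>z w. \<Delta> \<one> (\<lambda>x y. f x (y \<cdot> z) c) * \<phi> w)
          = \<Delta> (eps_hat A R \<phi>) (\<lambda>x y. f x y c)"
          unfolding N by (rule eps_hat_R(2)[OF \<phi> linear_form_shift(2)[OF bil[OF c]], symmetric])
        also have "\<dots> = \<Delta> \<one> (\<lambda>a z. \<Delta> a (\<lambda>x y. f x y c) * \<phi> z)"
          by (rule eps_hat_R(2)[OF \<phi> linear_form_comult])
        finally show "\<Delta> \<one> (\<lambda>z w. \<Delta> \<one> (\<lambda>x y. f x (y \<cdot> z) c) * \<phi> w)
          = \<Delta> \<one> (\<lambda>a z. \<Delta> a (\<lambda>x y. f x y c) * \<phi> z)" .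
      qed
    qed
  qed
qed

section \<open>Unconditional inclusions between \<open>N\<close>, \<open>range2\<close> and
  \<open>range1\<close>\<close>

lemma range2_subset_range1: "range2 A \<sigma> \<sigma>' \<subseteq> range1 A \<sigma>"
  by (auto simp: range2_def range1_def carrier_dual eps_closed)

lemma N_LL_subset: "N L L A \<subseteq> range2 A L L"
proof
  fix a assume "a \<in> N L L A"
  then have a: "a \<in> carrier A" and N: "\<And>f. bilin A f \<Longrightarrow> \<Delta> a f = \<Delta> \<one> (\<lambda>x y. f (a \<cdot> x) y)"
    unfolding N_LL_iff by auto
  \<comment> \<open>More than membership in the image holds: \<open>a\<close> is fixed by
    \<open>\<epsilon>\<^sub>L\<^sub>L\<close> and serves as its own preimage.\<close>
  have "a = eps_hat A L (eps A L a)"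
  proof (rule sp.linear_forms_separate[OF a eps_hat_closed[OF eps_closed[OF a]]])
    fix \<psi> assume \<psi>: "linear_form_on (scal A) (carrier A) \<psi>"
    have "\<psi> (eps_hat A L (eps A L a)) = \<Delta> \<one> (\<lambda>x y. eps A L a x * \<psi> y)"
      by (rule eps_hat_L(2)[OF eps_closed[OF a] \<psi>])
    also have "\<dots> = \<Delta> \<one> (\<lambda>x y. \<epsilon> (a \<cdot> x) * \<psi> y)"
      by (rule unit_tensor_cong) simp
    also have "\<dots> = \<Delta> a (\<lambda>x y. \<epsilon> x * \<psi> y)"
      by (rule N[symmetric]) (rule bilinear_form_on_mult[OF counit_linear \<psi>])
    also have "\<dots> = \<psi> a"
      by (rule counit_left_eval[OF a \<psi>])
    finally show "\<psi> a = \<psi> (eps_hat A L (eps A L a))" by simp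
  qed
  then show "a \<in> range2 A L L"
    unfolding range2_def using a by (metis comp_apply image_eqI)
qed

lemma N_RR_subset: "N R R A \<subseteq> range2 A R R"
proof
  fix a assume "a \<in> N R R A"
  then have a: "a \<in> carrier A" and N: "\<And>f. bilin A f \<Longrightarrow> \<Delta> a f = \<Delta> \<one> (\<lambda>x y. f x (y \<cdot> a))"
    unfolding N_RR_iff by auto
  have "a = eps_hat A R (eps A R a)"
  proof (rule sp.linear_forms_separate[OF a eps_hat_closed[OF eps_closed[OF a]]])
    fix \<psi> assume \<psi>: "linear_form_on (scal A) (carrier A) \<psi>"
    have "\<psi> (eps_hat A R (eps A R a)) = \<Delta> \<one> (\<lambda>x y. \<psi> x * eps A R a y)"
      by (rule eps_hat_R(2)[OF eps_closed[OF a] \<psi>])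
    also have "\<dots> = \<Delta> \<one> (\<lambda>x y. \<psi> x * \<epsilon> (y \<cdot> a))"
      by (rule unit_tensor_cong) simp
    also have "\<dots> = \<Delta> a (\<lambda>x y. \<psi> x * \<epsilon> y)"
      by (rule N[symmetric]) (rule bilinear_form_on_mult[OF \<psi> counit_linear])
    also have "\<dots> = \<psi> a"
      by (rule counit_right_eval[OF a \<psi>])
    finally show "\<psi> a = \<psi> (eps_hat A R (eps A R a))" by simp
  qed
  then show "a \<in> range2 A R R"
    unfolding range2_def using a by (metis comp_apply image_eqI)
qed

section \<open>Tensors over the dual\<close>

text \<open>In finite dimension the evaluations exhaust the forms on the dual, so a bilinear form
  \<open>F\<close> is a combination of products of evaluations at frame vectors, with coefficients
  \<open>F(e\<^sub>i, e\<^sub>j)\<close>. This yields both the uniqueness of the dual coproduct and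
  a test for equality with it.\<close>

lemma dual_tensor_eqI:
  assumes T: "T \<in> tensor_square fun_scale (dual_carrier A)"
    and T': "T' \<in> tensor_square fun_scale (dual_carrier A)"
    and eq: "\<And>a b. \<lbrakk>a \<in> carrier A; b \<in> carrier A\<rbrakk>
      \<Longrightarrow> T (\<lambda>\<phi> \<psi>. \<phi> a * \<psi> b) = T' (\<lambda>\<phi> \<psi>. \<phi> a * \<psi> b)"
  shows "T = T'"
proof
  fix F
  obtain n b e where *: "\<forall>i<n::nat. b i \<in> carrier A \<and> e i \<in> dual_carrier A"
    "\<forall>\<phi>\<in>dual_carrier A. \<phi> = (\<Sum>i<n. fun_scale (\<phi> (b i)) (e i))"
    by (rule dual_frame)
  show "T F = T' F"
  proof (cases "bilinear_form_on fun_scale (dual_carrier A) F")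
    case F: True
    have form: "f \<phi> = (\<Sum>i<n. \<phi> (b i) * f (e i))"
      if f: "linear_form_on fun_scale (dual_carrier A) f" and \<phi>: "\<phi> \<in> dual_carrier A" for f \<phi>
    proof -
      have "f \<phi> = f (\<Sum>i<n. fun_scale (\<phi> (b i)) (e i))"
        using *(2) \<phi> by metis
      also have "\<dots> = (\<Sum>i<n. f (fun_scale (\<phi> (b i)) (e i)))"
        by (rule du.linear_form_sum[OF f]) (use *(1) in auto)
      also have "\<dots> = (\<Sum>i<n. \<phi> (b i) * f (e i))"
        using *(1) f by (intro sum.cong) (auto simp: linear_form_onD)
      finally show ?thesis .
    qed
    have F_eq: "F \<phi> \<psi> = (\<Sum>(i, j)\<in>{..<n} \<times> {..<n}. F (e i) (e j) * (\<phi> (b i) * \<psi> (b j)))"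
      if \<phi>: "\<phi> \<in> dual_carrier A" and \<psi>: "\<psi> \<in> dual_carrier A" for \<phi> \<psi>
    proof -
      have "F \<phi> \<psi> = (\<Sum>i<n. \<phi> (b i) * F (e i) \<psi>)"
        using F \<psi> by (intro form[OF _ \<phi>]) (auto simp: bilinear_form_on_def)
      also have "\<dots> = (\<Sum>i<n. \<phi> (b i) * (\<Sum>j<n. \<psi> (b j) * F (e i) (e j)))"
        using F *(1) by (intro sum.cong refl arg_cong2[of _ _ _ _ "(*)"] form[OF _ \<psi>])
          (auto simp: bilinear_form_on_def)
      finally show ?thesis
        by (simp add: sum_distrib_left sum.cartesian_product algebra_simps)
    qed
    have expand: "S F = (\<Sum>(i, j)\<in>{..<n} \<times> {..<n}. F (e i) (e j) * S (\<lambda>\<phi> \<psi>. \<phi> (b i) * \<psi> (b j)))"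
      if S: "S \<in> tensor_square fun_scale (dual_carrier A)" for S
    proof -
      have bil: "bilinear_form_on fun_scale (dual_carrier A) (\<lambda>\<phi> \<psi>. c * (\<phi> x * \<psi> y))" for c x y
        by (auto simp: multilinear_defs fun_scale_def algebra_simps)
      have "S F = S (\<lambda>\<phi> \<psi>. \<Sum>p\<in>{..<n} \<times> {..<n}.
          F (e (fst p)) (e (snd p)) * (\<phi> (b (fst p)) * \<psi> (b (snd p))))"
        using F_eq by (intro du.tensor_cong[OF S]) (auto simp: case_prod_beta)
      also have "\<dots> = (\<Sum>p\<in>{..<n} \<times> {..<n}.
          S (\<lambda>\<phi> \<psi>. F (e (fst p)) (e (snd p)) * (\<phi> (b (fst p)) * \<psi> (b (snd p)))))"
        by (rule du.tensor_sum[OF S bil])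
      also have "\<dots> = (\<Sum>p\<in>{..<n} \<times> {..<n}.
          F (e (fst p)) (e (snd p)) * S (\<lambda>\<phi> \<psi>. \<phi> (b (fst p)) * \<psi> (b (snd p))))"
        by (intro sum.cong refl du.tensor_scale[OF S] bilinear_form_on_mult linear_form_eval)
      finally show ?thesis by (simp add: case_prod_beta)
    qed
    show ?thesis
      unfolding expand[OF T] expand[OF T'] using *(1) by (intro sum.cong) (auto simp: eq)
  qed (simp add: du.tensor_not_bilinear[OF T] du.tensor_not_bilinear[OF T'])
qed

lemma comult_dual:
  assumes \<phi>: "\<phi> \<in> dual_carrier A"
  shows "comult (dual A) \<phi> \<in> tensor_square fun_scale (dual_carrier A)"
    and "\<lbrakk>a \<in> carrier A; b \<in> carrier A\<rbrakk> \<Longrightarrow> comult (dual A) \<phi> (\<lambda>x y. x a * y b) = \<phi> (a \<cdot> b)"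
proof -
  let ?P = "\<lambda>T. T \<in> tensor_square fun_scale (dual_carrier A) \<and>
    (\<forall>a\<in>carrier A. \<forall>b\<in>carrier A. T (\<lambda>x y. x a * y b) = \<phi> (a \<cdot> b))"
  obtain n d e where *: "\<forall>i<n::nat. d i \<in> carrier A \<and> e i \<in> dual_carrier A"
    "\<forall>f. linear_form_on (scal A) (carrier A) f \<longrightarrow>
      (\<forall>x\<in>carrier A. f x = (\<Sum>i<n. e i x * f (d i)))"
    by (rule dual_frame)
  \<comment> \<open>The candidate is the sum of the
    \<open>\<phi>(d\<^sub>i d\<^sub>j) e\<^sub>i \<otimes> e\<^sub>j\<close>: expanding
    \<open>a\<close> and then \<open>b\<close> along the frame in \<open>\<phi>(ab)\<close> dictates
    these coefficients.\<close>
  define T where "T = (\<lambda>F. if bilinear_form_on fun_scale (dual_carrier A) F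
    then \<Sum>p\<in>{..<n} \<times> {..<n}. \<phi> (d (fst p) \<cdot> d (snd p)) * F (e (fst p)) (e (snd p)) else 0)"
  have "T \<in> tensor_square fun_scale (dual_carrier A)"
    unfolding T_def using *(1) by (intro du.tensorI) auto
  moreover have "T (\<lambda>x y. x a * y b) = \<phi> (a \<cdot> b)" if a: "a \<in> carrier A" and b: "b \<in> carrier A" for a b
  proof -
    have lin: "linear_form_on (scal A) (carrier A) (\<lambda>x. \<phi> (x \<cdot> b))"
      "\<And>c. c \<in> carrier A \<Longrightarrow> linear_form_on (scal A) (carrier A) (\<lambda>x. \<phi> (c \<cdot> x))"
      using b dual_carrierD[OF \<phi>] by (auto simp: multilinear_defs)
    have "\<phi> (a \<cdot> b) = (\<Sum>i<n. e i a * \<phi> (d i \<cdot> b))"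
      using *(2) lin(1) a by blast
    also have "\<dots> = (\<Sum>i<n. e i a * (\<Sum>j<n. e j b * \<phi> (d i \<cdot> d j)))"
      by (intro sum.cong refl arg_cong2[of _ _ _ _ "(*)"]) (use *(1,2) lin(2) b in blast)
    also have "\<dots> = (\<Sum>p\<in>{..<n} \<times> {..<n}. \<phi> (d (fst p) \<cdot> d (snd p)) * (e (fst p) a * e (snd p) b))"
      by (simp add: sum_distrib_left sum.cartesian_product case_prod_beta algebra_simps)
    finally show ?thesis
      by (simp add: T_def bilinear_form_on_mult linear_form_eval)
  qed
  ultimately have "?P T" by blast
  moreover have "S = T" if "?P S" for S
    using that \<open>?P T\<close> by (intro dual_tensor_eqI) auto
  ultimately have "?P (THE T. ?P T)"
    by (rule theI)
  then have "?P (comult (dual A) \<phi>)"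
    by (simp add: dual_def)
  then show "comult (dual A) \<phi> \<in> tensor_square fun_scale (dual_carrier A)"
    and "\<lbrakk>a \<in> carrier A; b \<in> carrier A\<rbrakk> \<Longrightarrow> comult (dual A) \<phi> (\<lambda>x y. x a * y b) = \<phi> (a \<cdot> b)"
    by blast+
qed

text \<open>Both sides are tensors over the dual, so products of evaluations decide, and on these
  the left side is \<open>\<phi>(ab)\<close>. Each condition defining an \<open>N\<close> of the
  dual has this shape. Linearity of \<open>g\<close> and \<open>h\<close> is stated pointwise, as
  products in the dual are given by their values.\<close>

lemma comult_dual_eq_tmap_iff:
  assumes \<phi>: "\<phi> \<in> dual_carrier A" and \<psi>: "\<psi> \<in> dual_carrier A"
    and g: "\<And>x. x \<in> dual_carrier A \<Longrightarrow> g x \<in> dual_carrier A"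
      "\<And>a. linear_form_on fun_scale (dual_carrier A) (\<lambda>x. g x a)"
    and h: "\<And>x. x \<in> dual_carrier A \<Longrightarrow> h x \<in> dual_carrier A"
      "\<And>a. linear_form_on fun_scale (dual_carrier A) (\<lambda>x. h x a)"
  shows "comult (dual A) \<phi> = tmap (dual A) g h (comult (dual A) \<psi>) \<longleftrightarrow>
    (\<forall>a\<in>carrier A. \<forall>b\<in>carrier A. \<phi> (a \<cdot> b) = comult (dual A) \<psi> (\<lambda>x y. g x a * h y b))"
proof -
  have bilin_dual: "bilin (dual A) = bilinear_form_on fun_scale (dual_carrier A)"
    by (simp add: dual_def)
  have g_lin: "g (x + y) = g x + g y" "g (fun_scale c x) = fun_scale c (g x)"
    and h_lin: "h (x + y) = h x + h y" "h (fun_scale c x) = fun_scale c (h x)"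
    if "x \<in> dual_carrier A" "y \<in> dual_carrier A" for x y c
    using linear_form_onD[OF g(2)] linear_form_onD[OF h(2)] that
    by (simp_all add: fun_eq_iff) (simp_all add: fun_scale_def)
  have bil: "bilinear_form_on fun_scale (dual_carrier A) (\<lambda>x y. F (g x) (h y))"
    if "bilinear_form_on fun_scale (dual_carrier A) F" for F
    using bilinear_form_onD[OF that] g h
    by (auto intro!: bilinear_form_onI simp: g_lin h_lin)
  have "tmap (dual A) g h (comult (dual A) \<psi>) \<in> tensor_square fun_scale (dual_carrier A)"
  proof -
    from comult_dual(1)[OF \<psi>] obtain n u v where *:
      "\<forall>i<n::nat. u i \<in> dual_carrier A \<and> v i \<in> dual_carrier A"
      "comult (dual A) \<psi> = (\<lambda>F. if bilinear_form_on fun_scale (dual_carrier A) F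
        then \<Sum>i<n. F (u i) (v i) else 0)"
      by (rule du.tensorE)
    have "tmap (dual A) g h (comult (dual A) \<psi>) =
      (\<lambda>F. if bilinear_form_on fun_scale (dual_carrier A) F
        then \<Sum>i\<in>{..<n}. 1 * F (g (u i)) (h (v i)) else 0)"
      by (auto simp: tmap_def bilin_dual *(2) bil)
    also have "\<dots> \<in> tensor_square fun_scale (dual_carrier A)"
      using *(1) g h by (intro du.tensorI) auto
    finally show ?thesis .
  qed
  note tensors = comult_dual(1)[OF \<phi>] this
  have eval: "tmap (dual A) g h (comult (dual A) \<psi>) (\<lambda>x y. x a * y b)
    = comult (dual A) \<psi> (\<lambda>x y. g x a * h y b)" for a b
    by (simp add: tmap_def bilin_dual bilinear_form_on_mult linear_form_eval)
  show ?thesis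
  proof (intro iffI ballI)
    fix a b
    assume eq: "comult (dual A) \<phi> = tmap (dual A) g h (comult (dual A) \<psi>)"
      and ab: "a \<in> carrier A" "b \<in> carrier A"
    show "\<phi> (a \<cdot> b) = comult (dual A) \<psi> (\<lambda>x y. g x a * h y b)"
      using comult_dual(2)[OF \<phi> ab] unfolding eq eval by simp
  qed (intro dual_tensor_eqI tensors; simp add: eval comult_dual(2)[OF \<phi>])
qed

section \<open>The spaces \<open>N\<close> of the dual as scalar identities\<close>

lemma mult_dual_apply:
  "a \<in> carrier A \<Longrightarrow> (\<phi> \<cdot>\<^bsub>dual A\<^esub> \<psi>) a = \<Delta> a (\<lambda>x y. \<phi> x * \<psi> y)"
  "a \<notin> carrier A \<Longrightarrow> (\<phi> \<cdot>\<^bsub>dual A\<^esub> \<psi>) a = 0"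
  by (simp_all add: dual_def)

lemma mult_dual_closed:
  assumes "\<phi> \<in> dual_carrier A" "\<psi> \<in> dual_carrier A"
  shows "\<phi> \<cdot>\<^bsub>dual A\<^esub> \<psi> \<in> dual_carrier A"
  using linear_form_comult[of "\<lambda>x y. \<phi> x * \<psi> y"]
  by (auto simp: dual_carrier_iff linear_form_on_def mult_dual_apply)

lemma linear_form_mult_dual:
  assumes \<phi>: "\<phi> \<in> dual_carrier A"
  shows "linear_form_on fun_scale (dual_carrier A) (\<lambda>x. (\<phi> \<cdot>\<^bsub>dual A\<^esub> x) a)"
    and "linear_form_on fun_scale (dual_carrier A) (\<lambda>x. (x \<cdot>\<^bsub>dual A\<^esub> \<phi>) a)"
proof -
  have "linear_form_on fun_scale (dual_carrier A) (\<lambda>x. \<Delta> a (\<lambda>u v. \<phi> u * x v))"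
    "linear_form_on fun_scale (dual_carrier A) (\<lambda>x. \<Delta> a (\<lambda>u v. x u * \<phi> v))"
    if a: "a \<in> carrier A"
    by (intro sp.linear_form_tensor[OF du.fd_space_axioms comult_closed[OF a]];
        use dual_carrierD[OF \<phi>] in \<open>auto simp: dual_carrier_iff multilinear_defs fun_scale_def algebra_simps\<close>)+
  \<comment> \<open>Outside the carrier a product in the dual has the value \<open>0\<close>; this
    settles the remaining arguments \<open>a\<close>.\<close>
  moreover have "linear_form_on fun_scale (dual_carrier A) (\<lambda>x. 0)"
    by (simp add: linear_form_on_def)
  ultimately show "linear_form_on fun_scale (dual_carrier A) (\<lambda>x. (\<phi> \<cdot>\<^bsub>dual A\<^esub> x) a)"
    and "linear_form_on fun_scale (dual_carrier A) (\<lambda>x. (x \<cdot>\<^bsub>dual A\<^esub> \<phi>) a)"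
    by (cases "a \<in> carrier A"; simp add: mult_dual_apply)+
qed

lemma unit_dual_closed: "\<one>\<^bsub>dual A\<^esub> \<in> dual_carrier A"
  using counit_linear by (auto simp: dual_def dual_carrier_iff linear_form_on_def)

text \<open>The coproduct of the dual unit, paired with two elements, gives
  \<open>\<epsilon>\<close> of their product. Interchanging it with \<open>\<Delta>(c)\<close> lets
  this be applied for each \<open>u\<close>, \<open>v\<close>. Here \<open>p\<close> and
  \<open>q\<close> are the elements met by the two legs, and \<open>k\<close> carries the factor
  \<open>\<phi>\<close>.\<close>

lemma comult_dual_unit_contract:
  assumes c: "c \<in> carrier A"
    and closed: "\<And>u v. \<lbrakk>u \<in> carrier A; v \<in> carrier A\<rbrakk> \<Longrightarrow> p u v \<in> carrier A"
      "\<And>u v. \<lbrakk>u \<in> carrier A; v \<in> carrier A\<rbrakk> \<Longrightarrow> q u v \<in> carrier A"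
    and bil: "\<And>x y. \<lbrakk>x \<in> dual_carrier A; y \<in> dual_carrier A\<rbrakk>
      \<Longrightarrow> bilin A (\<lambda>u v. k u v * (x (p u v) * y (q u v)))"
  shows "comult (dual A) \<one>\<^bsub>dual A\<^esub> (\<lambda>x y. \<Delta> c (\<lambda>u v. k u v * (x (p u v) * y (q u v))))
    = \<Delta> c (\<lambda>u v. k u v * \<epsilon> (p u v \<cdot> q u v))"
proof -
  let ?T = "comult (dual A) \<one>\<^bsub>dual A\<^esub>"
  note T = comult_dual(1)[OF unit_dual_closed]
  have "?T (\<lambda>x y. \<Delta> c (\<lambda>u v. k u v * (x (p u v) * y (q u v))))
    = \<Delta> c (\<lambda>u v. ?T (\<lambda>x y. k u v * (x (p u v) * y (q u v))))"
    by (rule du.tensor_fubini[OF sp.fd_space_axioms T comult_closed[OF c] bil])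
      (auto simp: multilinear_defs fun_scale_def algebra_simps)
  also have "\<dots> = \<Delta> c (\<lambda>u v. k u v * \<epsilon> (p u v \<cdot> q u v))"
  proof (rule sp.tensor_cong[OF comult_closed[OF c]])
    fix u v assume uv: "u \<in> carrier A" "v \<in> carrier A"
    have "?T (\<lambda>x y. k u v * (x (p u v) * y (q u v))) = k u v * ?T (\<lambda>x y. x (p u v) * y (q u v))"
      by (rule du.tensor_scale[OF T bilinear_form_on_mult[OF linear_form_eval linear_form_eval]])
    also have "?T (\<lambda>x y. x (p u v) * y (q u v)) = \<one>\<^bsub>dual A\<^esub> (p u v \<cdot> q u v)"
      by (rule comult_dual(2)[OF unit_dual_closed closed[OF uv]])
    also have "\<dots> = \<epsilon> (p u v \<cdot> q u v)"
      using closed[OF uv] by (simp add: dual_def)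
    finally show "?T (\<lambda>x y. k u v * (x (p u v) * y (q u v))) = k u v * \<epsilon> (p u v \<cdot> q u v)" .
  qed
  finally show ?thesis .
qed

lemma mult_dual_apply_scaled:
  assumes "a \<in> carrier A" "\<phi> \<in> dual_carrier A" "\<psi> \<in> dual_carrier A"
  shows "c * (\<phi> \<cdot>\<^bsub>dual A\<^esub> \<psi>) a = \<Delta> a (\<lambda>u v. c * (\<phi> u * \<psi> v))"
  using sp.tensor_scale[OF comult_closed[OF assms(1)]
      bilinear_form_on_mult[OF dual_carrierD[OF assms(2)] dual_carrierD[OF assms(3)]], of c]
  by (simp add: mult_dual_apply assms(1))

text \<open>At \<open>a\<close>, multiplying the first leg of the dual unit's coproduct by
  \<open>\<phi>\<close> splits \<open>a\<close> into \<open>\<phi>(a\<^sub>1)\<close> and that leg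
  at \<open>a\<^sub>2\<close>; with the other leg at \<open>b\<close> this leaves
  \<open>\<epsilon>(a\<^sub>2b)\<close>. In all four criteria the first index decides which of
  \<open>a\<close>, \<open>b\<close> is split, the second which half goes to
  \<open>\<phi>\<close>.\<close>

lemma N_dual_LL_iff:
  "\<phi> \<in> N L L (dual A) \<longleftrightarrow> \<phi> \<in> dual_carrier A \<and>
    (\<forall>a\<in>carrier A. \<forall>b\<in>carrier A. \<phi> (a \<cdot> b) = \<Delta> a (\<lambda>u v. \<phi> u * \<epsilon> (v \<cdot> b)))"
proof (cases "\<phi> \<in> dual_carrier A")
  case \<phi>: True
  have "comult (dual A) \<one>\<^bsub>dual A\<^esub> (\<lambda>x y. (\<phi> \<cdot>\<^bsub>dual A\<^esub> x) a * y b) = \<Delta> a (\<lambda>u v. \<phi> u * \<epsilon> (v \<cdot> b))"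
    if ab: "a \<in> carrier A" "b \<in> carrier A" for a b
  proof -
    have "comult (dual A) \<one>\<^bsub>dual A\<^esub> (\<lambda>x y. (\<phi> \<cdot>\<^bsub>dual A\<^esub> x) a * y b)
      = comult (dual A) \<one>\<^bsub>dual A\<^esub> (\<lambda>x y. \<Delta> a (\<lambda>u v. \<phi> u * (x v * y b)))"
      by (rule du.tensor_cong[OF comult_dual(1)[OF unit_dual_closed]])
        (simp add: mult_dual_apply_scaled \<phi> ab algebra_simps)
    also have "\<dots> = \<Delta> a (\<lambda>u v. \<phi> u * \<epsilon> (v \<cdot> b))"
      by (rule comult_dual_unit_contract)
        (use ab \<phi> in \<open>auto simp: dual_carrier_iff multilinear_defs algebra_simps\<close>)
    finally show ?thesis .
  qed
  moreover have "comult (dual A) \<phi> = tmap (dual A) (\<lambda>x. \<phi> \<cdot>\<^bsub>dual A\<^esub> x) (\<lambda>y. y) (comult (dual A) \<one>\<^bsub>dual A\<^esub>)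
    \<longleftrightarrow> (\<forall>a\<in>carrier A. \<forall>b\<in>carrier A.
      \<phi> (a \<cdot> b) = comult (dual A) \<one>\<^bsub>dual A\<^esub> (\<lambda>x y. (\<phi> \<cdot>\<^bsub>dual A\<^esub> x) a * y b))"
    by (rule comult_dual_eq_tmap_iff[OF \<phi> unit_dual_closed mult_dual_closed[OF \<phi>] linear_form_mult_dual(1)[OF \<phi>] _ linear_form_eval])
  ultimately show ?thesis
    using \<phi> by (simp add: carrier_dual)
qed (simp add: carrier_dual)

text \<open>This mixed criterion and the next one are matched later with those of the dual of the
  opposite algebra.\<close>

lemma N_dual_LR_iff:
  "\<phi> \<in> N L R (dual A) \<longleftrightarrow> \<phi> \<in> dual_carrier A \<and>
    (\<forall>a\<in>carrier A. \<forall>b\<in>carrier A. \<phi> (a \<cdot> b) = \<Delta> a (\<lambda>u v. \<phi> v * \<epsilon> (u \<cdot> b)))"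
proof (cases "\<phi> \<in> dual_carrier A")
  case \<phi>: True
  have "comult (dual A) \<one>\<^bsub>dual A\<^esub> (\<lambda>x y. (x \<cdot>\<^bsub>dual A\<^esub> \<phi>) a * y b) = \<Delta> a (\<lambda>u v. \<phi> v * \<epsilon> (u \<cdot> b))"
    if ab: "a \<in> carrier A" "b \<in> carrier A" for a b
  proof -
    have "comult (dual A) \<one>\<^bsub>dual A\<^esub> (\<lambda>x y. (x \<cdot>\<^bsub>dual A\<^esub> \<phi>) a * y b)
      = comult (dual A) \<one>\<^bsub>dual A\<^esub> (\<lambda>x y. \<Delta> a (\<lambda>u v. \<phi> v * (x u * y b)))"
      by (rule du.tensor_cong[OF comult_dual(1)[OF unit_dual_closed]])
        (simp add: mult_dual_apply_scaled \<phi> ab algebra_simps)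
    also have "\<dots> = \<Delta> a (\<lambda>u v. \<phi> v * \<epsilon> (u \<cdot> b))"
      by (rule comult_dual_unit_contract)
        (use ab \<phi> in \<open>auto simp: dual_carrier_iff multilinear_defs algebra_simps\<close>)
    finally show ?thesis .
  qed
  moreover have "comult (dual A) \<phi> = tmap (dual A) (\<lambda>x. x \<cdot>\<^bsub>dual A\<^esub> \<phi>) (\<lambda>y. y) (comult (dual A) \<one>\<^bsub>dual A\<^esub>)
    \<longleftrightarrow> (\<forall>a\<in>carrier A. \<forall>b\<in>carrier A.
      \<phi> (a \<cdot> b) = comult (dual A) \<one>\<^bsub>dual A\<^esub> (\<lambda>x y. (x \<cdot>\<^bsub>dual A\<^esub> \<phi>) a * y b))"
    by (rule comult_dual_eq_tmap_iff[OF \<phi> unit_dual_closed mult_dual_closed[OF _ \<phi>] linear_form_mult_dual(2)[OF \<phi>] _ linear_form_eval])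
  ultimately show ?thesis
    using \<phi> by (simp add: carrier_dual)
qed (simp add: carrier_dual)

lemma N_dual_RL_iff:
  "\<phi> \<in> N R L (dual A) \<longleftrightarrow> \<phi> \<in> dual_carrier A \<and>
    (\<forall>a\<in>carrier A. \<forall>b\<in>carrier A. \<phi> (a \<cdot> b) = \<Delta> b (\<lambda>u v. \<phi> u * \<epsilon> (a \<cdot> v)))"
proof (cases "\<phi> \<in> dual_carrier A")
  case \<phi>: True
  have "comult (dual A) \<one>\<^bsub>dual A\<^esub> (\<lambda>x y. x a * (\<phi> \<cdot>\<^bsub>dual A\<^esub> y) b) = \<Delta> b (\<lambda>u v. \<phi> u * \<epsilon> (a \<cdot> v))"
    if ab: "a \<in> carrier A" "b \<in> carrier A" for a b
  proof -
    have "comult (dual A) \<one>\<^bsub>dual A\<^esub> (\<lambda>x y. x a * (\<phi> \<cdot>\<^bsub>dual A\<^esub> y) b)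
      = comult (dual A) \<one>\<^bsub>dual A\<^esub> (\<lambda>x y. \<Delta> b (\<lambda>u v. \<phi> u * (x a * y v)))"
      by (rule du.tensor_cong[OF comult_dual(1)[OF unit_dual_closed]])
        (simp add: mult_dual_apply_scaled \<phi> ab algebra_simps)
    also have "\<dots> = \<Delta> b (\<lambda>u v. \<phi> u * \<epsilon> (a \<cdot> v))"
      by (rule comult_dual_unit_contract)
        (use ab \<phi> in \<open>auto simp: dual_carrier_iff multilinear_defs algebra_simps\<close>)
    finally show ?thesis .
  qed
  moreover have "comult (dual A) \<phi> = tmap (dual A) (\<lambda>x. x) (\<lambda>y. \<phi> \<cdot>\<^bsub>dual A\<^esub> y) (comult (dual A) \<one>\<^bsub>dual A\<^esub>)
    \<longleftrightarrow> (\<forall>a\<in>carrier A. \<forall>b\<in>carrier A.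
      \<phi> (a \<cdot> b) = comult (dual A) \<one>\<^bsub>dual A\<^esub> (\<lambda>x y. x a * (\<phi> \<cdot>\<^bsub>dual A\<^esub> y) b))"
    by (rule comult_dual_eq_tmap_iff[OF \<phi> unit_dual_closed _ linear_form_eval mult_dual_closed[OF \<phi>] linear_form_mult_dual(1)[OF \<phi>]])
  ultimately show ?thesis
    using \<phi> by (simp add: carrier_dual)
qed (simp add: carrier_dual)

lemma N_dual_RR_iff:
  "\<phi> \<in> N R R (dual A) \<longleftrightarrow> \<phi> \<in> dual_carrier A \<and>
    (\<forall>a\<in>carrier A. \<forall>b\<in>carrier A. \<phi> (a \<cdot> b) = \<Delta> b (\<lambda>u v. \<phi> v * \<epsilon> (a \<cdot> u)))"
proof (cases "\<phi> \<in> dual_carrier A")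
  case \<phi>: True
  have "comult (dual A) \<one>\<^bsub>dual A\<^esub> (\<lambda>x y. x a * (y \<cdot>\<^bsub>dual A\<^esub> \<phi>) b) = \<Delta> b (\<lambda>u v. \<phi> v * \<epsilon> (a \<cdot> u))"
    if ab: "a \<in> carrier A" "b \<in> carrier A" for a b
  proof -
    have "comult (dual A) \<one>\<^bsub>dual A\<^esub> (\<lambda>x y. x a * (y \<cdot>\<^bsub>dual A\<^esub> \<phi>) b)
      = comult (dual A) \<one>\<^bsub>dual A\<^esub> (\<lambda>x y. \<Delta> b (\<lambda>u v. \<phi> v * (x a * y u)))"
      by (rule du.tensor_cong[OF comult_dual(1)[OF unit_dual_closed]])
        (simp add: mult_dual_apply_scaled \<phi> ab algebra_simps)
    also have "\<dots> = \<Delta> b (\<lambda>u v. \<phi> v * \<epsilon> (a \<cdot> u))"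
      by (rule comult_dual_unit_contract)
        (use ab \<phi> in \<open>auto simp: dual_carrier_iff multilinear_defs algebra_simps\<close>)
    finally show ?thesis .
  qed
  moreover have "comult (dual A) \<phi> = tmap (dual A) (\<lambda>x. x) (\<lambda>y. y \<cdot>\<^bsub>dual A\<^esub> \<phi>) (comult (dual A) \<one>\<^bsub>dual A\<^esub>)
    \<longleftrightarrow> (\<forall>a\<in>carrier A. \<forall>b\<in>carrier A.
      \<phi> (a \<cdot> b) = comult (dual A) \<one>\<^bsub>dual A\<^esub> (\<lambda>x y. x a * (y \<cdot>\<^bsub>dual A\<^esub> \<phi>) b))"
    by (rule comult_dual_eq_tmap_iff[OF \<phi> unit_dual_closed _ linear_form_eval mult_dual_closed[OF _ \<phi>] linear_form_mult_dual(2)[OF \<phi>]])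
  ultimately show ?thesis
    using \<phi> by (simp add: carrier_dual)
qed (simp add: carrier_dual)

section \<open>The spaces \<open>N\<close> of the dual and the images of the counital maps\<close>

lemma N_dual_LL_subset: "N L L (dual A) \<subseteq> range2_hat A L L"
proof
  fix \<phi> assume "\<phi> \<in> N L L (dual A)"
  then have \<phi>: "\<phi> \<in> dual_carrier A"
    and N: "\<And>b. b \<in> carrier A \<Longrightarrow> \<phi> (\<one> \<cdot> b) = \<Delta> \<one> (\<lambda>u v. \<phi> u * \<epsilon> (v \<cdot> b))"
    unfolding N_dual_LL_iff using unit_closed by blast+
  have "\<phi> = eps A L (eps_hat A L \<phi>)"
  proof
    fix b
    show "\<phi> b = eps A L (eps_hat A L \<phi>) b"
    proof (cases "b \<in> carrier A")
      case True
      then have "linear_form_on (scal A) (carrier A) (\<lambda>x. \<epsilon> (x \<cdot> b))"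
        by (auto simp: multilinear_defs)
      then have "\<epsilon> (eps_hat A L \<phi> \<cdot> b) = \<Delta> \<one> (\<lambda>u v. \<phi> u * \<epsilon> (v \<cdot> b))"
        by (rule eps_hat_L(2)[OF \<phi>])
      with N[OF True] True show ?thesis by simp
    qed (use \<phi> in \<open>simp add: dual_carrier_iff\<close>)
  qed
  then show "\<phi> \<in> range2_hat A L L"
    unfolding range2_hat_def carrier_dual using \<phi> by (metis comp_apply image_eqI)
qed

lemma N_dual_RR_subset: "N R R (dual A) \<subseteq> range2_hat A R R"
proof
  fix \<phi> assume "\<phi> \<in> N R R (dual A)"
  then have \<phi>: "\<phi> \<in> dual_carrier A"
    and N: "\<And>a. a \<in> carrier A \<Longrightarrow> \<phi> (a \<cdot> \<one>) = \<Delta> \<one> (\<lambda>u v. \<phi> v * \<epsilon> (a \<cdot> u))"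
    unfolding N_dual_RR_iff using unit_closed by blast+
  have "\<phi> = eps A R (eps_hat A R \<phi>)"
  proof
    fix a
    show "\<phi> a = eps A R (eps_hat A R \<phi>) a"
    proof (cases "a \<in> carrier A")
      case True
      then have "linear_form_on (scal A) (carrier A) (\<lambda>x. \<epsilon> (a \<cdot> x))"
        by (auto simp: multilinear_defs)
      then have "\<epsilon> (a \<cdot> eps_hat A R \<phi>) = \<Delta> \<one> (\<lambda>u v. \<epsilon> (a \<cdot> u) * \<phi> v)"
        by (rule eps_hat_R(2)[OF \<phi>])
      with N[OF True] True show ?thesis by (simp add: mult.commute)
    qed (use \<phi> in \<open>simp add: dual_carrier_iff\<close>)
  qed
  then show "\<phi> \<in> range2_hat A R R"
    unfolding range2_hat_def carrier_dual using \<phi> by (metis comp_apply image_eqI)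
qed

text \<open>\<open>\<Delta>(xa) = \<Delta>(x)\<Delta>(a) = (x \<otimes> 1)\<Delta>(1)\<Delta>(a) =
  (x \<otimes> 1)\<Delta>(a)\<close>: the condition on \<open>x\<close> pulls it out of the first
  leg, and the remaining \<open>\<Delta>(1)\<close> is absorbed by multiplicativity.\<close>

lemma comult_N_LL_mult:
  assumes x: "x \<in> N L L A" and a: "a \<in> carrier A" and f: "bilin A f"
  shows "\<Delta> (x \<cdot> a) f = \<Delta> a (\<lambda>u v. f (x \<cdot> u) v)"
proof -
  have xc: "x \<in> carrier A" and N: "\<And>g. bilin A g \<Longrightarrow> \<Delta> x g = \<Delta> \<one> (\<lambda>p q. g (x \<cdot> p) q)"
    using x unfolding N_LL_iff by auto
  have "\<Delta> (x \<cdot> a) f = \<Delta> x (\<lambda>p q. \<Delta> a (\<lambda>u v. f (p \<cdot> u) (q \<cdot> v)))"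
    by (rule comult_mult_eval[OF xc a f])
  also have "\<dots> = \<Delta> \<one> (\<lambda>p q. \<Delta> a (\<lambda>u v. f (x \<cdot> p \<cdot> u) (q \<cdot> v)))"
    by (rule N, unfold bilinear_form_on_def, intro conjI ballI linear_form_tensor[OF comult_closed[OF a]])
      (use f in \<open>auto simp: multilinear_defs\<close>)
  also have "\<dots> = \<Delta> \<one> (\<lambda>p q. \<Delta> a (\<lambda>u v. f (x \<cdot> (p \<cdot> u)) (q \<cdot> v)))"
    by (rule unit_tensor_cong, rule sp.tensor_cong) (use xc a in \<open>auto simp: mult_assoc\<close>)
  also have "\<dots> = \<Delta> (\<one> \<cdot> a) (\<lambda>u v. f (x \<cdot> u) v)"
    by (rule comult_mult_eval[symmetric]) (use f xc a in \<open>auto simp: multilinear_defs\<close>)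
  finally show ?thesis using a by simp
qed

lemma comult_mult_N_RR:
  assumes x: "x \<in> N R R A" and a: "a \<in> carrier A" and f: "bilin A f"
  shows "\<Delta> (a \<cdot> x) f = \<Delta> a (\<lambda>u v. f u (v \<cdot> x))"
proof -
  have xc: "x \<in> carrier A" and N: "\<And>g. bilin A g \<Longrightarrow> \<Delta> x g = \<Delta> \<one> (\<lambda>p q. g p (q \<cdot> x))"
    using x unfolding N_RR_iff by auto
  have "\<Delta> (a \<cdot> x) f = \<Delta> a (\<lambda>u v. \<Delta> x (\<lambda>p q. f (u \<cdot> p) (v \<cdot> q)))"
    by (rule comult_mult_eval[OF a xc f])
  also have "\<dots> = \<Delta> a (\<lambda>u v. \<Delta> \<one> (\<lambda>p q. f (u \<cdot> p) (v \<cdot> (q \<cdot> x))))"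
    by (rule sp.tensor_cong[OF comult_closed[OF a]], rule N) (use f in \<open>auto simp: multilinear_defs\<close>)
  also have "\<dots> = \<Delta> a (\<lambda>u v. \<Delta> \<one> (\<lambda>p q. f (u \<cdot> p) (v \<cdot> q \<cdot> x)))"
    by (rule sp.tensor_cong[OF comult_closed[OF a]], rule unit_tensor_cong)
      (use xc a in \<open>auto simp: mult_assoc\<close>)
  also have "\<dots> = \<Delta> (a \<cdot> \<one>) (\<lambda>u v. f u (v \<cdot> x))"
    by (rule comult_mult_eval[symmetric]) (use f xc a in \<open>auto simp: multilinear_defs\<close>)
  finally show ?thesis using a by simp
qed

text \<open>By the formula for \<open>\<Delta>(xa)\<close>, the sum
  \<open>\<epsilon>(xa\<^sub>1)\<epsilon>(a\<^sub>2b)\<close> is a counit contraction of that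
  coproduct and collapses to \<open>\<epsilon>(xab)\<close>, the value of \<open>eps A L x\<close>
  at \<open>ab\<close>.\<close>

lemma eps_N_LL:
  assumes x: "x \<in> N L L A"
  shows "eps A L x \<in> N L L (dual A)"
  unfolding N_dual_LL_iff
proof (intro conjI ballI)
  have xc: "x \<in> carrier A" using x by simp
  then show "eps A L x \<in> dual_carrier A" by (rule eps_closed)
  fix a b assume a: "a \<in> carrier A" and b: "b \<in> carrier A"
  have lin: "linear_form_on (scal A) (carrier A) (\<lambda>v. \<epsilon> (v \<cdot> b))"
    using b by (auto simp: multilinear_defs)
  have "\<Delta> a (\<lambda>u v. eps A L x u * \<epsilon> (v \<cdot> b)) = \<Delta> a (\<lambda>u v. \<epsilon> (x \<cdot> u) * \<epsilon> (v \<cdot> b))"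
    by (rule sp.tensor_cong[OF comult_closed[OF a]]) simp
  also have "\<dots> = \<Delta> (x \<cdot> a) (\<lambda>u v. \<epsilon> u * \<epsilon> (v \<cdot> b))"
    by (rule comult_N_LL_mult[OF x a bilinear_form_on_mult[OF counit_linear lin], symmetric])
  also have "\<dots> = \<epsilon> (x \<cdot> a \<cdot> b)"
    by (rule counit_left_eval[OF mult_closed[OF xc a] lin])
  finally show "eps A L x (a \<cdot> b) = \<Delta> a (\<lambda>u v. eps A L x u * \<epsilon> (v \<cdot> b))"
    using a b xc by (simp add: mult_assoc)
qed

lemma eps_N_RR:
  assumes x: "x \<in> N R R A"
  shows "eps A R x \<in> N R R (dual A)"
  unfolding N_dual_RR_iff
proof (intro conjI ballI)
  have xc: "x \<in> carrier A" using x by simp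
  then show "eps A R x \<in> dual_carrier A" by (rule eps_closed)
  fix a b assume a: "a \<in> carrier A" and b: "b \<in> carrier A"
  have lin: "linear_form_on (scal A) (carrier A) (\<lambda>u. \<epsilon> (a \<cdot> u))"
    using a by (auto simp: multilinear_defs)
  have "\<Delta> b (\<lambda>u v. eps A R x v * \<epsilon> (a \<cdot> u)) = \<Delta> b (\<lambda>u v. \<epsilon> (a \<cdot> u) * \<epsilon> (v \<cdot> x))"
    by (rule sp.tensor_cong[OF comult_closed[OF b]]) simp
  also have "\<dots> = \<Delta> (b \<cdot> x) (\<lambda>u v. \<epsilon> (a \<cdot> u) * \<epsilon> v)"
    by (rule comult_mult_N_RR[OF x b bilinear_form_on_mult[OF lin counit_linear], symmetric])
  also have "\<dots> = \<epsilon> (a \<cdot> (b \<cdot> x))"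
    by (rule counit_right_eval[OF mult_closed[OF b xc] lin])
  finally show "eps A R x (a \<cdot> b) = \<Delta> b (\<lambda>u v. eps A R x v * \<epsilon> (a \<cdot> u))"
    using a b xc by (simp add: mult_assoc)
qed

lemma left_comonoidal_characterization:
  shows "left_comonoidal A \<longleftrightarrow> range1 A L = N L L A"
    and "left_comonoidal A \<longleftrightarrow> range1 A R = N R R A"
    and "left_comonoidal A \<Longrightarrow> N \<sigma> \<sigma> (dual A) = range2_hat A \<sigma> \<sigma> \<and> N \<sigma> \<sigma> A = range2 A \<sigma> \<sigma>"
proof -
  show "left_comonoidal A \<longleftrightarrow> range1 A L = N L L A"
    unfolding left_comonoidal_iff_L using N_LL_subset range2_subset_range1 by blast
  show "left_comonoidal A \<longleftrightarrow> range1 A R = N R R A"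
    unfolding left_comonoidal_iff_R using N_RR_subset range2_subset_range1 by blast
  assume lc: "left_comonoidal A"
  then have L: "range1 A L \<subseteq> N L L A" and R: "range1 A R \<subseteq> N R R A"
    by (simp_all only: left_comonoidal_iff_L[symmetric] left_comonoidal_iff_R[symmetric])
  \<comment> \<open>As a composite image, \<open>range2_hat A L L\<close> consists of the
    \<open>\<epsilon>\<^sub>L(x)\<close> with \<open>x\<close> in \<open>A\<^sub>L\<close>, so the
    inclusion of \<open>A\<^sub>L\<close> in \<open>N L L A\<close> carries over to the
    dual.\<close>
  have "range2_hat A L L \<subseteq> N L L (dual A)"
    unfolding range2_hat_def using L eps_N_LL by (auto simp only: range1_def comp_apply)
  moreover have "range2_hat A R R \<subseteq> N R R (dual A)"
    unfolding range2_hat_def using R eps_N_RR by (auto simp only: range1_def comp_apply)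
  \<comment> \<open>In \<open>A\<close> itself the spaces are squeezed:
    \<open>N \<subseteq> range2 \<subseteq> range1 \<subseteq> N\<close>.\<close>
  ultimately show "N \<sigma> \<sigma> (dual A) = range2_hat A \<sigma> \<sigma> \<and> N \<sigma> \<sigma> A = range2 A \<sigma> \<sigma>"
    using L R N_LL_subset N_RR_subset range2_subset_range1[of L L] range2_subset_range1[of R R]
      N_dual_LL_subset N_dual_RR_subset
    by (cases \<sigma>) blast+
qed

end

section \<open>The opposite algebra\<close>

text \<open>The coalgebra structure is left alone, so contractions of tensors and
  \<open>eps_hat\<close> stay literally the same; the change is seen only by what is built from
  products.\<close>

definition opposite :: "('k::field, 'a::ab_group_add) weak_bialg \<Rightarrow> ('k, 'a) weak_bialg" where
  "opposite A = A\<lparr>mult := \<lambda>x y. y \<cdot>\<^bsub>A\<^esub> x\<rparr>"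

lemma opposite_simps [simp]:
  "carrier (opposite A) = carrier A" "scal (opposite A) = scal A"
  "mult (opposite A) = (\<lambda>x y. y \<cdot>\<^bsub>A\<^esub> x)" "\<one>\<^bsub>opposite A\<^esub> = \<one>\<^bsub>A\<^esub>"
  "\<Delta>\<^bsub>opposite A\<^esub> = \<Delta>\<^bsub>A\<^esub>" "\<epsilon>\<^bsub>opposite A\<^esub> = \<epsilon>\<^bsub>A\<^esub>"
  by (simp_all add: opposite_def)

lemma opposite_tensor_simps [simp]:
  "tlift (opposite A) = tlift A" "tmap (opposite A) = tmap A"
  "comult_left (opposite A) = comult_left A" "comult_right (opposite A) = comult_right A"
  "dual_carrier (opposite A) = dual_carrier A"
  by (auto simp: fun_eq_iff tlift_def tmap_def comult_left_def comult_right_def dual_carrier_def)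

lemma eps_opposite [simp]: "eps (opposite A) L = eps A R" "eps (opposite A) R = eps A L"
  by (auto simp: fun_eq_iff)

lemma eps_hat_opposite [simp]: "eps_hat (opposite A) \<sigma> = eps_hat A \<sigma>"
  by (cases \<sigma>) (auto simp: fun_eq_iff)

lemma carrier_dual_opposite [simp]: "carrier (dual (opposite A)) = carrier (dual A)"
  by (simp add: dual_def)

lemma range_opposite:
  "range1 (opposite A) \<sigma> = range1 A \<sigma>"
  "range2 (opposite A) \<sigma> L = range2 A \<sigma> R" "range2 (opposite A) \<sigma> R = range2 A \<sigma> L"
  "range2_hat (opposite A) L \<sigma> = range2_hat A R \<sigma>" "range2_hat (opposite A) R \<sigma> = range2_hat A L \<sigma>"
  by (simp_all add: range1_def range2_def range2_hat_def)

lemma N_opposite: "N L L (opposite A) = N L R A" "N R R (opposite A) = N R L A"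
  by simp_all

context weak_bialgebra
begin

text \<open>The axiom with content is multiplicativity of the coproduct: \<open>\<Delta>(ba)\<close>
  nests \<open>\<Delta>(a)\<close> inside \<open>\<Delta>(b)\<close>, while the tensor product of
  the opposite algebra nests them the other way round, and interchanging the contractions reconciles
  the two.\<close>

lemma weak_bialgebra_opposite: "weak_bialgebra (opposite A)"
proof (rule weak_bialgebra.intro)
  fix a b assume a: "a \<in> carrier (opposite A)" and b: "b \<in> carrier (opposite A)"
  have "\<Delta> b (\<lambda>x y. \<Delta> a (\<lambda>z w. f (x \<cdot> z) (y \<cdot> w))) = \<Delta> a (\<lambda>z w. \<Delta> b (\<lambda>x y. f (x \<cdot> z) (y \<cdot> w)))"
    if "bilin A f" for f
    by (rule tensor_fubini[OF comult_closed comult_closed])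
      (use a b that in \<open>auto simp: multilinear_defs\<close>)
  then show "\<Delta>\<^bsub>opposite A\<^esub> (a \<cdot>\<^bsub>opposite A\<^esub> b) = tmult2 (opposite A) (\<Delta>\<^bsub>opposite A\<^esub> a) (\<Delta>\<^bsub>opposite A\<^esub> b)"
    using a b by (simp add: comult_mult tmult2_def fun_eq_iff)
qed (use vector_space subspace finite_dimensional counit_linear coassoc counit_left counit_right in
    \<open>auto simp: mult_assoc comult_add comult_scal\<close>)

lemma left_comonoidal_opposite: "left_comonoidal (opposite A) \<longleftrightarrow> right_comonoidal A"
  unfolding weak_bialgebra.left_comonoidal_iff[OF weak_bialgebra_opposite] right_comonoidal_iff
  by simp

text \<open>Reversing the product of \<open>A\<close> flips the legs of the dual coproduct and keeps
  the dual product, so the first index changes and the second stays. In the scalar criteria this is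
  a mere renaming of \<open>a\<close> and \<open>b\<close>.\<close>

lemma N_dual_opposite:
  "N L L (dual (opposite A)) = N R L (dual A)" "N R R (dual (opposite A)) = N L R (dual A)"
proof -
  have "\<phi> \<in> N L L (dual (opposite A)) \<longleftrightarrow> \<phi> \<in> N R L (dual A)" for \<phi>
    unfolding weak_bialgebra.N_dual_LL_iff[OF weak_bialgebra_opposite] N_dual_RL_iff by auto
  then show "N L L (dual (opposite A)) = N R L (dual A)" by blast
  have "\<phi> \<in> N R R (dual (opposite A)) \<longleftrightarrow> \<phi> \<in> N L R (dual A)" for \<phi>
    unfolding weak_bialgebra.N_dual_RR_iff[OF weak_bialgebra_opposite] N_dual_LR_iff by auto
  then show "N R R (dual (opposite A)) = N L R (dual A)" by blast
qed

end

theorem theorem3p5: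
  fixes A :: "('k::field, 'a::ab_group_add) weak_bialg"
  assumes "weak_bialgebra A"
  shows
    "((left_comonoidal A \<longleftrightarrow> range1 A L = N L L A) \<and>
      (range1 A L = N L L A \<longleftrightarrow> range1 A R = N R R A) \<and>
      (left_comonoidal A \<longrightarrow>
        (\<forall>\<sigma>. N \<sigma> \<sigma> (dual A) = range2_hat A \<sigma> \<sigma> \<and> N \<sigma> \<sigma> A = range2 A \<sigma> \<sigma>))) \<and>
     ((right_comonoidal A \<longleftrightarrow> range1 A L = N L R A) \<and>
      (range1 A L = N L R A \<longleftrightarrow> range1 A R = N R L A) \<and>
      (right_comonoidal A \<longrightarrow>
        (\<forall>(\<sigma>, \<sigma>') \<in> {(L, R), (R, L)}.
           N \<sigma> \<sigma>' (dual A) = range2_hat A \<sigma> \<sigma>' \<and> N \<sigma> \<sigma>' A = range2 A \<sigma> \<sigma>')))"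
proof -
  interpret weak_bialgebra A by (rule assms)
  note right = weak_bialgebra.left_comonoidal_characterization[OF weak_bialgebra_opposite,
    unfolded left_comonoidal_opposite range_opposite N_opposite]
  \<comment> \<open>For the opposite algebra the instance \<open>R\<close> speaks of
    \<open>(L, R)\<close> in the dual but of \<open>(R, L)\<close> in \<open>A\<close>, and the
    instance \<open>L\<close> the other way round. Each pair in the theorem thus draws on both
    instances.\<close>
  have LR: "N L R (dual A) = range2_hat A L R \<and> N R L A = range2 A R L"
    and RL: "N R L (dual A) = range2_hat A R L \<and> N L R A = range2 A L R" if "right_comonoidal A"
    using right(3)[OF that, of R] right(3)[OF that, of L]
    unfolding N_dual_opposite range_opposite N_opposite by blast+
  show ?thesis
    using left_comonoidal_characterization right(1,2) LR RL
    by (simp only: split_paired_Ball_Sigma) blast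
qed

end
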